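(* Let $d\ge 3$ be odd, $V=(\mathbb{C}^2)^{\otimes d}$, and let $\pmb{\lambda}=(\lambda^{(1)},\ldots,\lambda^{(d)})$ be a $d$-tuple of partitions of the same integer $m\le 2^{d-1}$, each with at most two columns (all parts at most $2$), such that $(\lambda^{(1)})'=(m)$. For $n=0,\ldots,2^{d-1}-m$ let $$U_{m+2n}:=\mathrm{HWV}_{\pmb{\lambda}'+(2\times n)^d}\bigwedge^{m+2n}V .$$ Let $X(v)=\omega\wedge v$ for $v\in\bigwedge V$, where $\omega=\omega_{d,2}$. Then the map $$X^\ell:\ U_{2^{d-1}-\ell}\longrightarrow U_{2^{d-1}+\ell}$$ is an isomorphism for $\ell=0,\ldots,m/2$ if $m$ is even, and for $\ell=1,\ldots,\lfloor m/2\rfloor$ if $m$ is odd.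
   Context: $\lambda'$ denotes the conjugate partition (componentwise on tuples). $(2\times n)^d$ is the $d$-tuple all of whose entries are $(n,n)$, and addition of tuples is componentwise (partitions of length at most $2$ being padded with zeros to vectors in $\mathbb{Z}^2$). For an index $r$ not of the form $m+2n$ with $0\le n\le 2^{d-1}-m$, $U_r$ is read as the zero space. The group $\mathrm{GL}(2)^{\times d}$ acts on $V$ multilinearly and hence on $\bigwedge V$. A vector $v$ is a weight vector of weight $\pmb{\mu}=(\mu^{(1)},\ldots,\mu^{(d)})$, $\mu^{(j)}\in\mathbb{Z}^2$, if every tuple of diagonal matrices $(\mathrm{diag}(a^{(1)}_1,a^{(1)}_2),\ldots,\mathrm{diag}(a^{(d)}_1,a^{(d)}_2))$ acts on $v$ as the scalar $\prod_j\prod_i (a^{(j)}_i)^{\mu^{(j)}_i}$. $\mathrm{HWV}_{\pmb{\mu}}\bigwedge^r V$ is the space consisting of $0$ and the nonzero weight vectors of weight $\pmb{\mu}$ in $\bigwedge^r V$ invariant under $U(2)^{\times d}$, with $U(2)$ the group of upper unitriangular matrices. The Cayley form is $$\omega_{d,2}=\sum_{\pi_1,\ldots,\pi_d\in S_2}\mathrm{sgn}(\pi_1\cdots\pi_d)\,\left(e_{\pi_1(1)}\otimes\cdots\otimes e_{\pi_d(1)}\right)\wedge\left(e_{\pi_1(2)}\otimes\cdots\otimes e_{\pi_d(2)}\right)\in\bigwedge^2V,$$ where $e_1,e_2$ is the standard basis of $\mathbb{C}^2$. *)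

theory Defs
  imports
    "HOL-Analysis.Analysis"
    "HOL-Combinatorics.Permutations"
    "HOL-Library.Function_Algebras"
    "HOL-Library.List_Lexorder"
begin

text \<open>
  Tensors and exterior powers are modelled by coordinates. The tensors
  \<open>e\<^sub>w = e\<^bsub>w!0\<^esub> \<otimes> \<dots> \<otimes> e\<^bsub>w!(d-1)\<^esub>\<close>, with \<open>w\<close> a word of length \<open>d\<close> over \<open>{1,2}\<close>, form a basis of
  \<open>V = (\<complex>\<^sup>2)\<^sup>\<otimes>\<^sup>d\<close>; a vector of \<open>V\<close> is its coefficient function, vanishing off \<open>words d\<close>.
  For a finite set \<open>S = {w\<^sub>1 < \<dots> < w\<^sub>r}\<close> of words (lexicographic order)
  put \<open>e\<^sub>S = e\<^bsub>w\<^sub>1\<^esub> \<and> \<dots> \<and> e\<^bsub>w\<^sub>r\<^esub>\<close>; an element of \<open>\<And>V\<close> is its coefficient function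
  with respect to the basis \<open>e\<^sub>S\<close>, \<open>S \<subseteq> words d\<close>, and vanishes off these \<open>S\<close>.
  The tensor factors are numbered \<open>0, \<dots>, d-1\<close>, and in the type \<open>2\<close> of indices of
  \<open>complex^2\<close> the index \<open>2\<close> is a name for \<open>0\<close>.
\<close>

type_synonym word = "2 list"
type_synonym tensor = "word \<Rightarrow> complex"
type_synonym ext = "word set \<Rightarrow> complex"

definition words :: "nat \<Rightarrow> word set" where
  "words d = {w. length w = d}"

definition pure_tensor :: "nat \<Rightarrow> (nat \<Rightarrow> complex^2) \<Rightarrow> tensor" where
  "pure_tensor d x = (\<lambda>w. if w \<in> words d then \<Prod>j<d. x j $ (w ! j) else 0)"

definition tensor_scale :: "complex \<Rightarrow> tensor \<Rightarrow> tensor" where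
  "tensor_scale c x = (\<lambda>w. c * x w)"

definition ext_scale :: "complex \<Rightarrow> ext \<Rightarrow> ext" where
  "ext_scale c v = (\<lambda>S. c * v S)"

definition ext_pow :: "nat \<Rightarrow> nat \<Rightarrow> ext set" where
  "ext_pow d r = {v. \<forall>S. v S \<noteq> 0 \<longrightarrow> S \<subseteq> words d \<and> card S = r}"

definition ext_one :: ext where
  "ext_one = (\<lambda>S. if S = {} then 1 else 0)"

definition ext_incl :: "tensor \<Rightarrow> ext" where
  "ext_incl x = (\<lambda>S. if is_singleton S then x (the_elem S) else 0)"

text \<open>
  \<open>e\<^sub>A \<and> e\<^sub>B\<close> is \<open>0\<close> unless \<open>A\<close> and \<open>B\<close> are disjoint, and then it is \<open>\<plusminus> e\<^bsub>A \<union> B\<^esub>\<close> with the sign of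
  the permutation sorting the concatenation of the increasing enumerations of \<open>A\<close> and \<open>B\<close>.
\<close>

definition shuffle_sign :: "word set \<Rightarrow> word set \<Rightarrow> complex" where
  "shuffle_sign A B = (-1) ^ card {(a, b). a \<in> A \<and> b \<in> B \<and> b < a}"

definition wedge :: "ext \<Rightarrow> ext \<Rightarrow> ext" where
  "wedge u v = (\<lambda>S. \<Sum>A\<in>Pow S. shuffle_sign A (S - A) * u A * v (S - A))"

definition wedge_list :: "tensor list \<Rightarrow> ext" where
  "wedge_list xs = foldr (\<lambda>x. wedge (ext_incl x)) xs ext_one"

text \<open>
  The multilinear action of a \<open>d\<close>-tuple of matrices on \<open>V\<close>, and the induced action on \<open>\<And>V\<close>.
\<close>

definition tensor_act :: "nat \<Rightarrow> (nat \<Rightarrow> complex^2^2) \<Rightarrow> tensor \<Rightarrow> tensor" where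
  "tensor_act d g x =
     (\<Sum>w\<in>words d. tensor_scale (x w) (pure_tensor d (\<lambda>j. g j *v axis (w ! j) 1)))"

definition ext_act :: "nat \<Rightarrow> (nat \<Rightarrow> complex^2^2) \<Rightarrow> ext \<Rightarrow> ext" where
  "ext_act d g v = (\<Sum>S\<in>Pow (words d). ext_scale (v S)
     (wedge_list (map (\<lambda>w. tensor_act d g (pure_tensor d (\<lambda>j. axis (w ! j) 1)))
        (sorted_list_of_set S))))"

definition diag_mat :: "complex^2 \<Rightarrow> complex^2^2" where
  "diag_mat a = (\<chi> i k. if i = k then a $ i else 0)"

definition upper_unitriangular :: "complex^2^2 \<Rightarrow> bool" where
  "upper_unitriangular A \<longleftrightarrow> A $ 1 $ 1 = 1 \<and> A $ 2 $ 2 = 1 \<and> A $ 2 $ 1 = 0"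

definition weight_vector :: "nat \<Rightarrow> (nat \<Rightarrow> int^2) \<Rightarrow> ext \<Rightarrow> bool" where
  "weight_vector d \<mu> v \<longleftrightarrow>
     (\<forall>a. (\<forall>j<d. \<forall>i. a j $ i \<noteq> 0) \<longrightarrow>
        ext_act d (\<lambda>j. diag_mat (a j)) v =
          ext_scale (\<Prod>j<d. \<Prod>i\<in>UNIV. a j $ i powi (\<mu> j $ i)) v)"

text \<open>With this convention the zero vector is a weight vector of every weight.\<close>

definition HWV :: "nat \<Rightarrow> (nat \<Rightarrow> int^2) \<Rightarrow> nat \<Rightarrow> ext set" where
  "HWV d \<mu> r = {v \<in> ext_pow d r. weight_vector d \<mu> v \<and>
     (\<forall>g. (\<forall>j<d. upper_unitriangular (g j)) \<longrightarrow> ext_act d g v = v)}"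

definition cayley :: "nat \<Rightarrow> ext" where
  "cayley d = (\<Sum>\<pi>\<in>PiE {..<d} (\<lambda>_. {p. p permutes (UNIV :: 2 set)}).
     ext_scale (of_int (\<Prod>j<d. sign (\<pi> j)))
       (wedge (ext_incl (pure_tensor d (\<lambda>j. axis (\<pi> j 1) 1)))
              (ext_incl (pure_tensor d (\<lambda>j. axis (\<pi> j 2) 1)))))"

text \<open>A partition is the sequence of its parts, indexed from \<open>0\<close> and padded with zeros.\<close>

definition is_partition :: "nat \<Rightarrow> (nat \<Rightarrow> nat) \<Rightarrow> bool" where
  "is_partition m p \<longleftrightarrow> antimono p \<and> finite {i. p i \<noteq> 0} \<and> (\<Sum>i | p i \<noteq> 0. p i) = m"

definition conj_partition :: "(nat \<Rightarrow> nat) \<Rightarrow> (nat \<Rightarrow> nat)" where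
  "conj_partition p = (\<lambda>k. card {i. k < p i})"

definition single_row :: "nat \<Rightarrow> (nat \<Rightarrow> nat)" where
  "single_row m = (\<lambda>k. if k = 0 then m else 0)"

definition two_rows :: "(nat \<Rightarrow> nat) \<Rightarrow> int^2" where
  "two_rows p = vector [int (p 0), int (p 1)]"

definition hw_space :: "nat \<Rightarrow> nat \<Rightarrow> (nat \<Rightarrow> nat \<Rightarrow> nat) \<Rightarrow> nat \<Rightarrow> ext set" where
  "hw_space d m lam r = {v. v = 0 \<or>
     (\<exists>n \<le> 2 ^ (d - 1) - m. r = m + 2 * n \<and>
        v \<in> HWV d (\<lambda>j. two_rows (conj_partition (lam j)) + vector [int n, int n]) r)}"

definition linear_iso :: "ext set \<Rightarrow> ext set \<Rightarrow> (ext \<Rightarrow> ext) \<Rightarrow> bool" where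
  "linear_iso U W f \<longleftrightarrow>
     module.subspace ext_scale U \<and> module.subspace ext_scale W \<and>
     (\<forall>u\<in>U. \<forall>v\<in>U. f (u + v) = f u + f v) \<and>
     (\<forall>c. \<forall>u\<in>U. f (ext_scale c u) = ext_scale c (f u)) \<and>
     bij_betw f U W"

end

theory Submission
  imports Defs
begin

text \<open>
  For odd \<open>d\<close> the Cayley form \<open>\<omega>\<close> is a nondegenerate bivector: up to nonzero coefficients it is the sum
  of \<open>e\<^sub>w \<and> e\<^bsub>w'\<^esub>\<close> over the \<open>2\<^sup>d\<^sup>-\<^sup>1\<close> pairs of complementary words. Hence \<open>\<omega>\<^sup>l\<close> is bijective from degree
  \<open>2\<^sup>d\<^sup>-\<^sup>1 - l\<close> to degree \<open>2\<^sup>d\<^sup>-\<^sup>1 + l\<close> of the whole exterior algebra (hard Lefschetz). Since a tuple \<open>g\<close>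
  of matrices multiplies \<open>\<omega>\<close> by the product of the determinants, this bijection matches the highest
  weight vectors of weight \<open>\<mu>\<close> with those of weight \<open>\<mu> + (l, l)\<close>.
\<close>

subsection \<open>The wedge product\<close>

text \<open>The conditions on a highest weight vector are equations inside one degree. An injective
  map that commutes with the group up to a nonzero scalar transports such equations in both
  directions, so the preimage of a highest weight vector is again one and no dimensions have to be
  compared. For hard Lefschetz the obstacle is that removing a pair \<open>{p, q}\<close> leaves
  vectors containing exactly one of \<open>e\<^sub>p\<close>, \<open>e\<^sub>q\<close>, on which
  only the remaining pairs act. The statement is therefore proved relative to a prescribed set
  \<open>T\<close> of occupied indices, with degrees counted relative to \<open>T\<close>.
  Injectivity and surjectivity go through the induction side by side. That the action respects
  products comes down to one fact: the sign rule for \<open>e\<^sub>S \<and> e\<^sub>T\<close> uses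
  only anticommutativity and vanishing squares, so it holds for arbitrary vectors in place of the
  basis vectors \<open>e\<^sub>w\<close>.\<close>

lemma sum_fun_apply: "(\<Sum>i\<in>I. f i) x = (\<Sum>i\<in>I. f i x)"
  for f :: "'i \<Rightarrow> 'a \<Rightarrow> 'b::comm_monoid_add"
  by (induction I rule: infinite_finite_induct) auto

text \<open>Both sides run over the ordered pairs of disjoint subsets of \<open>S\<close>, grouped
  by their union on the left and by the first member on the right. Associativity and the
  multiplicativity of the action both rest on this regrouping.\<close>

lemma sum_disjoint_pairs:
  fixes h :: "'a set \<Rightarrow> 'a set \<Rightarrow> 'b::comm_monoid_add"
  assumes "finite S"
  shows "(\<Sum>D\<in>Pow S. \<Sum>A\<in>Pow D. h A (D - A)) = (\<Sum>A\<in>Pow S. \<Sum>B\<in>Pow (S - A). h A B)"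
proof -
  have fin: "finite D" if "D \<subseteq> S" for D
    using that assms finite_subset by blast
  have "(\<Sum>D\<in>Pow S. \<Sum>A\<in>Pow D. h A (D - A)) =
      (\<Sum>(D, A)\<in>Sigma (Pow S) Pow. h A (D - A))"
    by (rule sum.Sigma) (use assms fin in auto)
  also have "\<dots> = (\<Sum>(A, B)\<in>Sigma (Pow S) (\<lambda>A. Pow (S - A)). h A B)"
    by (rule sum.reindex_bij_witness[where j = "\<lambda>(D, A). (A, D - A)" and i = "\<lambda>(A, B). (A \<union> B, A)"]) auto
  also have "\<dots> = (\<Sum>A\<in>Pow S. \<Sum>B\<in>Pow (S - A). h A B)"
    by (rule sum.Sigma[symmetric]) (use assms in auto)
  finally show ?thesis .
qed

section \<open>Signs of shuffles\<close>

lemma finite_inversions: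
  "finite A \<Longrightarrow> finite B \<Longrightarrow> finite {(a, b). a \<in> A \<and> b \<in> B \<and> P a b}"
  by (rule finite_subset[of _ "A \<times> B"]) auto

lemma shuffle_sign_nonzero [simp]: "shuffle_sign A B \<noteq> 0"
  by (simp add: shuffle_sign_def)

lemma shuffle_sign_empty [simp]: "shuffle_sign {} B = 1" "shuffle_sign A {} = 1"
  by (simp_all add: shuffle_sign_def)

lemma shuffle_sign_Un_left:
  assumes "finite A" "finite B" "finite C" "A \<inter> B = {}"
  shows "shuffle_sign (A \<union> B) C = shuffle_sign A C * shuffle_sign B C"
proof -
  have "{(a, b). a \<in> A \<union> B \<and> b \<in> C \<and> b < a} =
      {(a, b). a \<in> A \<and> b \<in> C \<and> b < a} \<union> {(a, b). a \<in> B \<and> b \<in> C \<and> b < a}"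
    by auto
  moreover have "card \<dots> = card {(a, b). a \<in> A \<and> b \<in> C \<and> b < a} + card {(a, b). a \<in> B \<and> b \<in> C \<and> b < a}"
    by (rule card_Un_disjoint) (use assms in \<open>auto intro!: finite_inversions\<close>)
  ultimately show ?thesis
    by (simp add: shuffle_sign_def power_add)
qed

lemma shuffle_sign_Un_right:
  assumes "finite A" "finite B" "finite C" "B \<inter> C = {}"
  shows "shuffle_sign A (B \<union> C) = shuffle_sign A B * shuffle_sign A C"
proof -
  have "{(a, b). a \<in> A \<and> b \<in> B \<union> C \<and> b < a} =
      {(a, b). a \<in> A \<and> b \<in> B \<and> b < a} \<union> {(a, b). a \<in> A \<and> b \<in> C \<and> b < a}"
    by auto
  moreover have "card \<dots> = card {(a, b). a \<in> A \<and> b \<in> B \<and> b < a} + card {(a, b). a \<in> A \<and> b \<in> C \<and> b < a}"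
    by (rule card_Un_disjoint) (use assms in \<open>auto intro!: finite_inversions\<close>)
  ultimately show ?thesis
    by (simp add: shuffle_sign_def power_add)
qed

text \<open>Every pair in \<open>A \<times> B\<close> is an inversion for exactly one of the two
  orders of concatenation, so the two inversion counts add up to
  \<open>card A * card B\<close>.\<close>

lemma shuffle_sign_commute:
  assumes "finite A" "finite B" "A \<inter> B = {}"
  shows "shuffle_sign A B = (-1) ^ (card A * card B) * shuffle_sign B A"
proof -
  let ?I = "{(a, b). a \<in> A \<and> b \<in> B \<and> b < a}" and ?J = "{(b, a). b \<in> B \<and> a \<in> A \<and> a < b}"
  have "A \<times> B = ?I \<union> prod.swap ` ?J"
  proof (intro set_eqI iffI)
    fix z assume z: "z \<in> A \<times> B"
    obtain x y where xy: "z = (x, y)"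
      by fastforce
    with z assms(3) have "y < x \<or> x < y"
      by (metis disjoint_iff linorder_less_linear mem_Sigma_iff)
    then show "z \<in> ?I \<union> prod.swap ` ?J"
      using z xy by (auto intro!: image_eqI[of _ prod.swap "(y, x)"])
  qed auto
  moreover have "card (?I \<union> prod.swap ` ?J) = card ?I + card (prod.swap ` ?J)"
    by (rule card_Un_disjoint) (use assms in \<open>auto intro!: finite_inversions\<close>)
  moreover have "card (prod.swap ` ?J) = card ?J"
    by (rule card_image) simp
  ultimately have *: "card A * card B = card ?I + card ?J"
    by (simp flip: card_cartesian_product)
  have "(-1::complex) ^ (card ?I + card ?J) * (-1) ^ card ?J = (-1) ^ card ?I"
    by (simp add: power_add mult.assoc)
  then show ?thesis
    by (simp add: shuffle_sign_def *)
qed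

lemma shuffle_sign_less:
  "(\<And>a b. a \<in> A \<Longrightarrow> b \<in> B \<Longrightarrow> a < b) \<Longrightarrow> shuffle_sign A B = 1"
proof -
  assume "\<And>a b. a \<in> A \<Longrightarrow> b \<in> B \<Longrightarrow> a < b"
  then have "{(a, b). a \<in> A \<and> b \<in> B \<and> b < a} = {}"
    by force
  then show ?thesis
    by (simp only: shuffle_sign_def) simp
qed

section \<open>Bilinearity, associativity and graded commutativity\<close>

lemma wedge_add_left: "wedge (u + u') v = wedge u v + wedge u' v"
  by (rule ext) (simp add: wedge_def sum.distrib algebra_simps)

lemma wedge_add_right: "wedge u (v + v') = wedge u v + wedge u v'"
  by (rule ext) (simp add: wedge_def sum.distrib algebra_simps)

lemma wedge_scale_left: "wedge (ext_scale c u) v = ext_scale c (wedge u v)"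
  by (rule ext) (simp add: wedge_def ext_scale_def sum_distrib_left algebra_simps)

lemma wedge_scale_right: "wedge u (ext_scale c v) = ext_scale c (wedge u v)"
  by (rule ext) (simp add: wedge_def ext_scale_def sum_distrib_left algebra_simps)

lemma wedge_zero_left [simp]: "wedge 0 v = 0"
  by (rule ext) (simp add: wedge_def)

lemma wedge_zero_right [simp]: "wedge u 0 = 0"
  by (rule ext) (simp add: wedge_def)

lemma wedge_sum_left: "wedge (\<Sum>i\<in>I. u i) v = (\<Sum>i\<in>I. wedge (u i) v)"
  by (induction I rule: infinite_finite_induct) (simp_all only: sum.infinite sum.empty sum.insert wedge_zero_left wedge_add_left simp_thms)

lemma wedge_sum_right: "wedge u (\<Sum>i\<in>I. v i) = (\<Sum>i\<in>I. wedge u (v i))"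
  by (induction I rule: infinite_finite_induct) (simp_all only: sum.infinite sum.empty sum.insert wedge_zero_right wedge_add_right simp_thms)

lemma wedge_nonzeroE:
  assumes "wedge u v S \<noteq> 0"
  obtains A where "A \<subseteq> S" "finite S" "u A \<noteq> 0" "v (S - A) \<noteq> 0"
proof -
  \<comment> \<open>For infinite \<open>S\<close> the index set \<open>Pow S\<close> is infinite and
    the sum defining \<open>wedge\<close> is \<open>0\<close> by convention.\<close>
  have "finite S"
    by (rule ccontr) (use assms in \<open>simp add: wedge_def\<close>)
  moreover obtain A where "A \<in> Pow S" "shuffle_sign A (S - A) * u A * v (S - A) \<noteq> 0"
    using assms unfolding wedge_def by (meson sum.not_neutral_contains_not_neutral)
  ultimately show ?thesis
    using that by auto
qed

lemma wedge_assoc: "wedge (wedge u v) w = wedge u (wedge v w)"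
proof (rule ext)
  fix S
  show "wedge (wedge u v) w S = wedge u (wedge v w) S"
  proof (cases "finite S")
    case False
    then show ?thesis
      by (simp add: wedge_def)
  next
    case True
    then have fin: "finite X" if "X \<subseteq> S" for X
      using that finite_subset by blast
    \<comment> \<open>The contribution of the ordered triple \<open>A\<close>, \<open>B\<close>,
      \<open>S - A - B\<close>. Its sign is a product over the three pairs of blocks, which does not
      depend on the bracketing.\<close>
    let ?h = "\<lambda>A B. shuffle_sign A B * shuffle_sign A (S - A - B) * shuffle_sign B (S - A - B) *
      u A * v B * w (S - A - B)"
    have "wedge (wedge u v) w S = (\<Sum>D\<in>Pow S. \<Sum>A\<in>Pow D. ?h A (D - A))"
      unfolding wedge_def sum_distrib_left sum_distrib_right
    proof (intro sum.cong refl)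
      fix D A assume *: "D \<in> Pow S" "A \<in> Pow D"
      then have "S - A - (D - A) = S - D" "A \<union> (D - A) = D"
        by auto
      moreover have "shuffle_sign (A \<union> (D - A)) (S - D) =
          shuffle_sign A (S - D) * shuffle_sign (D - A) (S - D)"
        by (rule shuffle_sign_Un_left) (use * fin in auto)
      ultimately show "shuffle_sign D (S - D) * (shuffle_sign A (D - A) * u A * v (D - A)) * w (S - D) =
          ?h A (D - A)"
        by simp
    qed
    also have "\<dots> = (\<Sum>A\<in>Pow S. \<Sum>B\<in>Pow (S - A). ?h A B)"
      by (rule sum_disjoint_pairs[OF True])
    also have "\<dots> = wedge u (wedge v w) S"
      unfolding wedge_def sum_distrib_left sum_distrib_right
    proof (intro sum.cong refl)
      fix A B assume *: "A \<in> Pow S" "B \<in> Pow (S - A)"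
      then have "S - A = B \<union> (S - A - B)"
        by auto
      moreover have "shuffle_sign A (B \<union> (S - A - B)) =
          shuffle_sign A B * shuffle_sign A (S - A - B)"
        by (rule shuffle_sign_Un_right) (use * fin[of A] fin[of B] fin[of "S - A - B"] in auto)
      ultimately have "shuffle_sign A (S - A) = shuffle_sign A B * shuffle_sign A (S - A - B)"
        by simp
      then show "?h A B = shuffle_sign A (S - A) * u A *
          (shuffle_sign B (S - A - B) * v B * w (S - A - B))"
        by (simp only: mult_ac)
    qed
    finally show ?thesis .
  qed
qed

text \<open>A single scalar \<open>c\<close> must serve all supports: it is \<open>1\<close> if one
  factor is even and \<open>-1\<close> for two vectors.\<close>

lemma wedge_graded_commute:
  assumes "\<And>A B. u A \<noteq> 0 \<Longrightarrow> v B \<noteq> 0 \<Longrightarrow> (-1) ^ (card A * card B) = c"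
  shows "wedge u v = ext_scale c (wedge v u)"
proof (rule ext)
  fix S
  show "wedge u v S = ext_scale c (wedge v u) S"
  proof (cases "finite S")
    case False
    then show ?thesis
      by (simp add: wedge_def ext_scale_def)
  next
    case True
    have "wedge u v S = (\<Sum>A\<in>Pow S. shuffle_sign (S - A) A * u (S - A) * v A)"
      unfolding wedge_def
      by (rule sum.reindex_bij_witness[where j = "\<lambda>A. S - A" and i = "\<lambda>A. S - A"])
        (auto simp: double_diff)
    also have "\<dots> = (\<Sum>A\<in>Pow S. c * (shuffle_sign A (S - A) * v A * u (S - A)))"
    proof (intro sum.cong refl)
      fix A assume A: "A \<in> Pow S"
      show "shuffle_sign (S - A) A * u (S - A) * v A =
          c * (shuffle_sign A (S - A) * v A * u (S - A))"
      proof (cases "u (S - A) = 0 \<or> v A = 0")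
        case False
        have "shuffle_sign (S - A) A = (-1) ^ (card (S - A) * card A) * shuffle_sign A (S - A)"
          by (rule shuffle_sign_commute) (use A True finite_subset in auto)
        then show ?thesis
          using False assms[of "S - A" A] by simp
      qed auto
    qed
    finally show ?thesis
      by (simp add: wedge_def ext_scale_def sum_distrib_left)
  qed
qed

lemma wedge_even_commute:
  assumes "\<And>A. u A \<noteq> 0 \<Longrightarrow> even (card A)"
  shows "wedge u v = wedge v u"
  using wedge_graded_commute[of u v 1] assms by (simp add: ext_scale_def)

lemma ext_incl_nonzeroD: "ext_incl x A \<noteq> 0 \<Longrightarrow> \<exists>a. A = {a} \<and> x a \<noteq> 0"
  by (auto simp: ext_incl_def is_singleton_def split: if_splits)

lemma wedge_ext_incl_commute:
  "wedge (ext_incl x) (ext_incl y) = ext_scale (-1) (wedge (ext_incl y) (ext_incl x))"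
  by (rule wedge_graded_commute) (auto dest!: ext_incl_nonzeroD)

lemma wedge_ext_incl_self: "wedge (ext_incl x) (ext_incl x) = 0"
proof (rule ext)
  fix S
  have "wedge (ext_incl x) (ext_incl x) S = - wedge (ext_incl x) (ext_incl x) S"
    using fun_cong[OF wedge_ext_incl_commute[of x x], of S] by (simp add: ext_scale_def)
  then show "wedge (ext_incl x) (ext_incl x) S = 0 S"
    by simp
qed

text \<open>The support condition is there because \<open>wedge\<close> produces the coefficient
  \<open>0\<close> at every infinite set.\<close>

lemma wedge_ext_one_left: "(\<And>S. v S \<noteq> 0 \<Longrightarrow> finite S) \<Longrightarrow> wedge ext_one v = v"
proof (rule ext)
  fix S
  assume v: "\<And>S. v S \<noteq> 0 \<Longrightarrow> finite S"
  have "wedge ext_one v S = (\<Sum>A\<in>Pow S. if A = {} then v S else 0)"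
    unfolding wedge_def ext_one_def by (intro sum.cong) auto
  also have "\<dots> = v S"
    using v[of S] by (cases "finite S") auto
  finally show "wedge ext_one v S = v S" .
qed

lemma wedge_ext_one_right: "(\<And>S. v S \<noteq> 0 \<Longrightarrow> finite S) \<Longrightarrow> wedge v ext_one = v"
  using wedge_even_commute[of ext_one v] wedge_ext_one_left[of v]
  by (auto simp: ext_one_def split: if_splits)

lemma wedge_list_Nil [simp]: "wedge_list [] = ext_one"
  and wedge_list_Cons [simp]: "wedge_list (x # xs) = wedge (ext_incl x) (wedge_list xs)"
  by (simp_all add: wedge_list_def)

lemma wedge_list_nonzeroD:
  assumes "wedge_list xs S \<noteq> 0" "\<And>x w. x \<in> set xs \<Longrightarrow> x w \<noteq> 0 \<Longrightarrow> w \<in> W"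
  shows "finite S \<and> card S = length xs \<and> S \<subseteq> W"
  using assms
proof (induction xs arbitrary: S)
  case Nil
  then show ?case
    by (auto simp: ext_one_def split: if_splits)
next
  case (Cons x xs)
  from Cons.prems(1) have "wedge (ext_incl x) (wedge_list xs) S \<noteq> 0"
    by simp
  then obtain A where A: "A \<subseteq> S" "finite S" "ext_incl x A \<noteq> 0" "wedge_list xs (S - A) \<noteq> 0"
    by (rule wedge_nonzeroE)
  then obtain a where a: "A = {a}" "x a \<noteq> 0"
    using ext_incl_nonzeroD by blast
  have "finite (S - A) \<and> card (S - A) = length xs \<and> S - A \<subseteq> W"
    using Cons.IH[OF A(4)] Cons.prems(2) by (meson list.set_intros(2))
  moreover have "a \<in> W"
    using Cons.prems(2)[of x a] a by simp
  ultimately show ?case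
    using A a card.remove[of S a] by auto
qed

subsection \<open>The induced action on the exterior algebra\<close>

text \<open>With \<open>G = act_basis d g\<close> this is the image of \<open>e\<^sub>S\<close>
  under \<open>g\<close>. The vectors \<open>G w\<close> may be arbitrary, even linearly
  dependent.\<close>

definition wedge_set :: "(word \<Rightarrow> tensor) \<Rightarrow> word set \<Rightarrow> ext" where
  "wedge_set G S = wedge_list (map G (sorted_list_of_set S))"

lemma wedge_set_empty [simp]: "wedge_set G {} = ext_one"
  by (simp add: wedge_set_def)

lemma wedge_set_insert_less:
  assumes "finite S" "\<forall>a\<in>S. w < a"
  shows "wedge_set G (insert w S) = wedge (ext_incl (G w)) (wedge_set G S)"
proof -
  have "sorted_list_of_set (insert w S) = w # sorted_list_of_set S"
    using assms by (subst sorted_list_of_set_insert) (auto intro!: insort_is_Cons less_imp_le)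
  then show ?thesis
    by (simp add: wedge_set_def)
qed

lemma wedge_set_nonzeroD:
  assumes "wedge_set G S R \<noteq> 0" "finite S" "\<And>u w. u \<in> S \<Longrightarrow> G u w \<noteq> 0 \<Longrightarrow> w \<in> W"
  shows "finite R" "card R = card S" "R \<subseteq> W"
proof -
  have "finite R \<and> card R = length (map G (sorted_list_of_set S)) \<and> R \<subseteq> W"
    using assms by (intro wedge_list_nonzeroD) (auto simp: wedge_set_def)
  then show "finite R" "card R = card S" "R \<subseteq> W"
    using assms(2) by auto
qed

lemma ext_scale_scale [simp]: "ext_scale a (ext_scale b v) = ext_scale (a * b) v"
  by (simp add: ext_scale_def mult.assoc)

lemma ext_scale_one [simp]: "ext_scale 1 v = v"
  by (simp add: ext_scale_def)

lemma ext_scale_zero [simp]: "ext_scale 0 v = 0" "ext_scale c 0 = 0"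
  by (simp_all add: ext_scale_def fun_eq_iff)

text \<open>The new factor moves to its sorted position, at the cost of one sign for each smaller
  index passed; a repeated factor gives zero. The induction always inserts a new least element
  \<open>b\<close>, which is thus the leading factor.\<close>

lemma wedge_incl_wedge_set:
  assumes "finite S"
  shows "wedge (ext_incl (G w)) (wedge_set G S) =
    ext_scale (if w \<in> S then 0 else shuffle_sign {w} S) (wedge_set G (insert w S))"
  using assms
proof (induction S rule: finite_linorder_min_induct)
  case empty
  then show ?case
    using wedge_set_insert_less[of "{}" w G] by simp
next
  case (insert b S)
  let ?i = "\<lambda>w. ext_incl (G w)"
  have b: "wedge_set G (insert b S) = wedge (?i b) (wedge_set G S)" "b \<notin> S"
    using insert.hyps by (auto intro!: wedge_set_insert_less)
  consider "w = b" | "w < b" | "b < w"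
    by (meson linorder_less_linear)
  then show ?case
  proof cases
    case 1
    have "wedge (?i b) (wedge_set G (insert b S)) = wedge (wedge (?i b) (?i b)) (wedge_set G S)"
      by (simp add: b wedge_assoc)
    then show ?thesis
      using 1 by (simp add: wedge_ext_incl_self)
  next
    case 2
    then have less: "\<forall>a\<in>insert b S. w < a"
      using insert.hyps less_trans by blast
    then have "w \<notin> insert b S"
      by blast
    moreover have "shuffle_sign {w} (insert b S) = 1"
      by (rule shuffle_sign_less) (use less in auto)
    ultimately show ?thesis
      using wedge_set_insert_less[of "insert b S" w G] insert.hyps less by simp
  next
    \<comment> \<open>Here \<open>b\<close> has to stay in front; exchanging the two vectors
      accounts for the one new inversion \<open>(w, b)\<close>.\<close>
    case 3
    have "wedge (?i w) (wedge_set G (insert b S)) = wedge (wedge (?i w) (?i b)) (wedge_set G S)"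
      by (simp add: b wedge_assoc)
    also have "\<dots> = ext_scale (-1) (wedge (?i b) (wedge (?i w) (wedge_set G S)))"
      by (subst wedge_ext_incl_commute) (simp add: wedge_scale_left wedge_assoc)
    also have "\<dots> = ext_scale (if w \<in> S then 0 else - shuffle_sign {w} S)
        (wedge (?i b) (wedge_set G (insert w S)))"
      unfolding insert.IH by (simp add: wedge_scale_right)
    also have "wedge (?i b) (wedge_set G (insert w S)) = wedge_set G (insert w (insert b S))"
      using 3 insert.hyps wedge_set_insert_less[of "insert w S" b G] by (simp add: insert_commute)
    also have "- shuffle_sign {w} S = shuffle_sign {w} (insert b S)"
    proof -
      have "shuffle_sign {w} ({b} \<union> S) = shuffle_sign {w} {b} * shuffle_sign {w} S"
        by (rule shuffle_sign_Un_right) (use insert.hyps in auto)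
      moreover have "{(x, y). x = w \<and> y = b \<and> y < x} = {(w, b)}"
        using 3 by auto
      then have "shuffle_sign {w} {b} = -1"
        by (simp add: shuffle_sign_def)
      ultimately show ?thesis
        by simp
    qed
    finally show ?thesis
      using 3 by auto
  qed
qed

text \<open>The structure constants of the basis \<open>e\<^sub>S\<close> survive any substitution
  \<open>G\<close> of vectors; this is what makes the induced action multiplicative.\<close>

lemma wedge_wedge_set:
  assumes "finite S" "finite T"
  shows "wedge (wedge_set G S) (wedge_set G T) =
    ext_scale (if S \<inter> T = {} then shuffle_sign S T else 0) (wedge_set G (S \<union> T))"
  using assms(1)
proof (induction S rule: finite_linorder_min_induct)
  case empty
  have "finite R" if "wedge_set G T R \<noteq> 0" for R
    by (rule wedge_set_nonzeroD(1)[OF that assms(2), of UNIV]) auto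
  then show ?case
    by (simp add: wedge_ext_one_left)
next
  case (insert b S)
  have b: "b \<notin> S"
    using insert.hyps by auto
  have "wedge (wedge_set G (insert b S)) (wedge_set G T) =
      wedge (ext_incl (G b)) (wedge (wedge_set G S) (wedge_set G T))"
    using insert.hyps by (simp add: wedge_set_insert_less wedge_assoc)
  also have "\<dots> = ext_scale ((if S \<inter> T = {} then shuffle_sign S T else 0) *
      (if b \<in> S \<union> T then 0 else shuffle_sign {b} (S \<union> T))) (wedge_set G (insert b (S \<union> T)))"
    using insert.hyps assms(2)
    by (simp only: insert.IH wedge_scale_right wedge_incl_wedge_set finite_Un ext_scale_scale)
  also have "(if S \<inter> T = {} then shuffle_sign S T else 0) *
      (if b \<in> S \<union> T then 0 else shuffle_sign {b} (S \<union> T)) =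
      (if insert b S \<inter> T = {} then shuffle_sign (insert b S) T else 0)"
  proof (cases "insert b S \<inter> T = {}")
    case True
    have "shuffle_sign {b} (S \<union> T) = shuffle_sign {b} S * shuffle_sign {b} T"
      by (rule shuffle_sign_Un_right) (use True insert.hyps assms in auto)
    moreover have "shuffle_sign {b} S = 1"
      by (rule shuffle_sign_less) (use insert.hyps in auto)
    moreover have "shuffle_sign ({b} \<union> S) T = shuffle_sign {b} T * shuffle_sign S T"
      by (rule shuffle_sign_Un_left) (use b insert.hyps assms in auto)
    ultimately show ?thesis
      using True b by simp
  next
    case False
    then show ?thesis
      using b by auto
  qed
  finally show ?case
    by simp
qed

section \<open>Matrix coefficients of the action and its multiplicativity\<close>

lemma finite_words [simp]: "finite (words d)"
  using finite_lists_length_eq[of "UNIV :: 2 set" d] by (simp add: words_def)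

lemma card_words: "card (words d) = 2 ^ d"
  using card_lists_length_eq[of "UNIV :: 2 set" d] by (simp add: words_def)

definition act_basis :: "nat \<Rightarrow> (nat \<Rightarrow> complex^2^2) \<Rightarrow> word \<Rightarrow> tensor" where
  "act_basis d g w = tensor_act d g (pure_tensor d (\<lambda>j. axis (w ! j) 1))"

lemma pure_tensor_axis:
  "pure_tensor d (\<lambda>j. axis (f j) 1) = (\<lambda>w. if w = map f [0..<d] then 1 else 0)"
proof (rule ext)
  fix w
  show "pure_tensor d (\<lambda>j. axis (f j) 1) w = (if w = map f [0..<d] then 1 else 0)"
  proof (cases "w = map f [0..<d]")
    case True
    then show ?thesis
      by (auto simp: pure_tensor_def words_def axis_def intro!: prod.neutral)
  next
    case False
    have "\<exists>j<d. w ! j \<noteq> f j" if "length w = d"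
      using that False by (auto simp: list_eq_iff_nth_eq)
    then show ?thesis
      using False by (auto simp: pure_tensor_def words_def axis_def intro!: prod_zero)
  qed
qed

lemma pure_tensor_word:
  "w \<in> words d \<Longrightarrow> pure_tensor d (\<lambda>j. axis (w ! j) 1) = (\<lambda>u. if u = w then 1 else 0)"
  unfolding pure_tensor_axis words_def by (metis (mono_tags, lifting) map_nth mem_Collect_eq)

lemma matrix_mult_axis: "(A *v axis k (1::'a::semiring_1)) $ i = A $ i $ k"
  by (simp add: matrix_vector_mult_def axis_def if_distrib cong: if_cong)

text \<open>These are the entries of column \<open>w\<close> of the Kronecker product of the
  matrices \<open>g j\<close>.\<close>

lemma act_basis_apply:
  assumes "w \<in> words d"
  shows "act_basis d g w u = (if u \<in> words d then \<Prod>j<d. g j $ (u ! j) $ (w ! j) else 0)"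
proof -
  have "act_basis d g w u = (\<Sum>v\<in>words d. (if v = w then 1 else 0) *
      pure_tensor d (\<lambda>j. g j *v axis (v ! j) 1) u)"
    unfolding act_basis_def tensor_act_def pure_tensor_word[OF assms]
    by (simp add: sum_fun_apply tensor_scale_def)
  also have "\<dots> = (\<Sum>v\<in>words d. if v = w then pure_tensor d (\<lambda>j. g j *v axis (w ! j) 1) u else 0)"
    by (intro sum.cong) auto
  also have "\<dots> = pure_tensor d (\<lambda>j. g j *v axis (w ! j) 1) u"
    using assms by simp
  finally show ?thesis
    by (simp add: pure_tensor_def matrix_mult_axis)
qed

lemma ext_act_eq: "ext_act d g v = (\<Sum>S\<in>Pow (words d). ext_scale (v S) (wedge_set (act_basis d g) S))"
  by (simp add: ext_act_def wedge_set_def act_basis_def[abs_def])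

lemma ext_act_apply: "ext_act d g v R = (\<Sum>S\<in>Pow (words d). v S * wedge_set (act_basis d g) S R)"
  unfolding ext_act_eq sum_fun_apply by (simp add: ext_scale_def)

lemma ext_act_add: "ext_act d g (u + v) = ext_act d g u + ext_act d g v"
  by (rule ext) (simp add: ext_act_apply distrib_right sum.distrib)

lemma ext_act_scale: "ext_act d g (ext_scale c v) = ext_scale c (ext_act d g v)"
  by (rule ext) (simp add: ext_act_apply ext_scale_def sum_distrib_left mult.assoc)

lemma ext_act_zero [simp]: "ext_act d g 0 = 0"
  by (rule ext) (simp add: ext_act_apply)

lemma ext_act_sum: "ext_act d g (\<Sum>i\<in>I. v i) = (\<Sum>i\<in>I. ext_act d g (v i))"
  by (induction I rule: infinite_finite_induct)
    (simp_all only: sum.infinite sum.empty sum.insert ext_act_zero ext_act_add simp_thms)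

text \<open>Expanding both factors, a product of images of \<open>e\<^sub>A\<close> and
  \<open>e\<^sub>B\<close> vanishes when \<open>A\<close> and \<open>B\<close> meet and otherwise
  carries the same shuffle sign as \<open>e\<^sub>A \<and> e\<^sub>B\<close> itself. Regrouping by
  \<open>D = A \<union> B\<close> gives the coefficients of \<open>wedge u v\<close>.\<close>

lemma ext_act_wedge: "ext_act d g (wedge u v) = wedge (ext_act d g u) (ext_act d g v)"
proof (rule ext)
  fix R
  let ?W = "wedge_set (act_basis d g)" and ?P = "Pow (words d)"
  have fin: "finite S" if "S \<subseteq> words d" for S
    using that finite_words finite_subset by blast
  have "wedge (ext_act d g u) (ext_act d g v) R =
      (\<Sum>A\<in>?P. \<Sum>B\<in>?P. u A * v B * wedge (?W A) (?W B) R)"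
    unfolding ext_act_eq wedge_sum_left wedge_scale_left
    unfolding wedge_sum_right wedge_scale_right
    by (simp add: ext_scale_def sum_fun_apply sum_distrib_left mult.assoc)
  also have "\<dots> = (\<Sum>A\<in>?P. \<Sum>B\<in>Pow (words d - A). u A * v B * shuffle_sign A B * ?W (A \<union> B) R)"
  proof (rule sum.cong[OF refl])
    fix A assume A: "A \<in> ?P"
    show "(\<Sum>B\<in>?P. u A * v B * wedge (?W A) (?W B) R) =
        (\<Sum>B\<in>Pow (words d - A). u A * v B * shuffle_sign A B * ?W (A \<union> B) R)"
    proof (rule sum.mono_neutral_cong_right)
      show "\<forall>B\<in>?P - Pow (words d - A). u A * v B * wedge (?W A) (?W B) R = 0"
      proof
        fix B assume B: "B \<in> ?P - Pow (words d - A)"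
        then have "A \<inter> B \<noteq> {}"
          by auto
        then show "u A * v B * wedge (?W A) (?W B) R = 0"
          using A B fin by (simp add: wedge_wedge_set)
      qed
      fix B assume B: "B \<in> Pow (words d - A)"
      then have "A \<inter> B = {}" "finite A" "finite B"
        using A fin by auto
      then show "u A * v B * wedge (?W A) (?W B) R = u A * v B * shuffle_sign A B * ?W (A \<union> B) R"
        by (simp add: wedge_wedge_set ext_scale_def)
    qed auto
  qed
  also have "\<dots> = (\<Sum>D\<in>?P. \<Sum>A\<in>Pow D. u A * v (D - A) * shuffle_sign A (D - A) * ?W (A \<union> (D - A)) R)"
    by (rule sum_disjoint_pairs[symmetric]) simp
  also have "\<dots> = ext_act d g (wedge u v) R"
    unfolding ext_act_apply wedge_def sum_distrib_right
    by (intro sum.cong refl) (auto simp: Un_absorb2 ac_simps)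
  finally show "ext_act d g (wedge u v) R = wedge (ext_act d g u) (ext_act d g v) R" ..
qed

lemma ext_act_ext_pow: "v \<in> ext_pow d r \<Longrightarrow> ext_act d g v \<in> ext_pow d r"
  unfolding ext_pow_def
proof safe
  fix R
  assume v: "\<forall>S. v S \<noteq> 0 \<longrightarrow> S \<subseteq> words d \<and> card S = r" and nz: "ext_act d g v R \<noteq> 0"
  from nz obtain S where "S \<in> Pow (words d)" "v S * wedge_set (act_basis d g) S R \<noteq> 0"
    unfolding ext_act_apply by (rule sum.not_neutral_contains_not_neutral)
  then have S: "S \<subseteq> words d" "v S \<noteq> 0" "wedge_set (act_basis d g) S R \<noteq> 0"
    by auto
  have "finite S"
    using S(1) finite_words finite_subset by blast
  moreover have "w \<in> words d" if "u \<in> S" "act_basis d g u w \<noteq> 0" for u w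
    using that S(1) by (auto simp: act_basis_apply subset_iff split: if_splits)
  ultimately have "card R = card S" "R \<subseteq> words d"
    using wedge_set_nonzeroD[OF S(3), of "words d"] by blast+
  then show "card R = r" "\<And>x. x \<in> R \<Longrightarrow> x \<in> words d"
    using v S(2) by auto
qed

lemma ext_act_incl_word:
  assumes "w \<in> words d"
  shows "ext_act d g (ext_incl (\<lambda>u. if u = w then 1 else 0)) = ext_incl (act_basis d g w)"
proof -
  have *: "ext_incl (\<lambda>u. if u = w then 1 else 0) S = (if S = {w} then 1 else 0)" for S
    by (auto simp: ext_incl_def is_singleton_def)
  have "ext_act d g (ext_incl (\<lambda>u. if u = w then 1 else 0)) =
      (\<Sum>S\<in>Pow (words d). if S = {w} then wedge_set (act_basis d g) S else 0)"
    unfolding ext_act_eq * by (intro sum.cong) auto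
  also have "\<dots> = wedge (ext_incl (act_basis d g w)) ext_one"
    using assms wedge_set_insert_less[of "{}" w "act_basis d g"] by simp
  also have "\<dots> = ext_incl (act_basis d g w)"
    by (rule wedge_ext_one_right) (auto dest: ext_incl_nonzeroD)
  finally show ?thesis .
qed

lemma ext_incl_expand:
  assumes "\<And>w. x w \<noteq> 0 \<Longrightarrow> w \<in> W" "finite W"
  shows "ext_incl x = (\<Sum>w\<in>W. ext_scale (x w) (ext_incl (\<lambda>u. if u = w then 1 else 0)))"
proof (rule ext)
  fix S
  have "ext_incl x S = (\<Sum>w\<in>W. if S = {w} then x w else 0)"
  proof (cases "is_singleton S")
    case True
    then obtain a where a: "S = {a}"
      by (auto simp: is_singleton_def)
    then show ?thesis
      using assms by (auto simp: ext_incl_def eq_commute[of a])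
  qed (auto simp: ext_incl_def is_singleton_def intro!: sum.neutral[symmetric])
  also have "\<dots> = (\<Sum>w\<in>W. ext_scale (x w) (ext_incl (\<lambda>u. if u = w then 1 else 0))) S"
    unfolding sum_fun_apply
    by (intro sum.cong refl) (auto simp: ext_scale_def ext_incl_def is_singleton_def)
  finally show "ext_incl x S = (\<Sum>w\<in>W. ext_scale (x w) (ext_incl (\<lambda>u. if u = w then 1 else 0))) S" .
qed

subsection \<open>Hard Lefschetz for bivectors of disjoint pairs\<close>

text \<open>For a set \<open>P\<close> of pairwise disjoint two-element sets \<open>{p, q}\<close>, this is the bivector
  \<open>\<Sum> \<plusminus> \<gamma> {p, q} e\<^sub>p \<and> e\<^sub>q\<close>.\<close>

definition pair_form :: "(word set \<Rightarrow> complex) \<Rightarrow> word set set \<Rightarrow> ext" where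
  "pair_form \<gamma> P = (\<lambda>S. if S \<in> P then \<gamma> S else 0)"

text \<open>Outside of the pairs the set of indices is prescribed to be \<open>T\<close>; on the pairs the degree
  is \<open>r\<close>. An integer degree makes the spaces of negative degree zero.\<close>

definition rel_pow :: "word set set \<Rightarrow> word set \<Rightarrow> int \<Rightarrow> ext set" where
  "rel_pow P T r = {v. \<forall>S. v S \<noteq> 0 \<longrightarrow> finite S \<and> T \<subseteq> S \<and> S \<subseteq> T \<union> \<Union>P \<and> int (card S) = int (card T) + r}"

text \<open>For a pair \<open>D\<close> the four choices \<open>A \<subseteq> D\<close> record how
  the pair is occupied; the induction on pairs works with this direct sum.\<close>

definition sector :: "word set \<Rightarrow> word set \<Rightarrow> ext \<Rightarrow> ext" where
  "sector D A v = (\<lambda>S. if S \<inter> D = A then v S else 0)"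

lemma rel_powD:
  assumes "v \<in> rel_pow P T r" "v S \<noteq> 0"
  shows "finite S" "T \<subseteq> S" "S \<subseteq> T \<union> \<Union>P" "int (card S) = int (card T) + r"
  using assms by (auto simp: rel_pow_def)

lemma rel_pow_zero [simp]: "0 \<in> rel_pow P T r"
  by (simp add: rel_pow_def)

lemma rel_pow_add: "u \<in> rel_pow P T r \<Longrightarrow> v \<in> rel_pow P T r \<Longrightarrow> u + v \<in> rel_pow P T r"
  unfolding rel_pow_def mem_Collect_eq plus_fun_apply by (metis add.right_neutral)

lemma rel_pow_scale: "v \<in> rel_pow P T r \<Longrightarrow> ext_scale c v \<in> rel_pow P T r"
  by (auto simp: rel_pow_def ext_scale_def)

lemma pair_form_insert:
  "D \<notin> P \<Longrightarrow> pair_form \<gamma> (insert D P) = pair_form \<gamma> P + pair_form \<gamma> {D}"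
  by (rule ext) (auto simp: pair_form_def)

lemma pair_form_nonzeroD: "pair_form \<gamma> P S \<noteq> 0 \<Longrightarrow> S \<in> P"
  by (simp add: pair_form_def split: if_splits)

lemma ext_scale_add: "ext_scale c (u + v) = ext_scale c u + ext_scale c v"
  by (rule ext) (simp add: ext_scale_def distrib_left)

lemma funpow_wedge_add: "(wedge u ^^ k) (v + w) = (wedge u ^^ k) v + (wedge u ^^ k) w"
  by (induction k) (simp_all only: funpow.simps o_apply id_apply wedge_add_right)

lemma funpow_wedge_scale: "(wedge u ^^ k) (ext_scale c v) = ext_scale c ((wedge u ^^ k) v)"
  by (induction k) (simp_all only: funpow.simps o_apply id_apply wedge_scale_right)

lemma funpow_wedge_zero [simp]: "(wedge u ^^ k) 0 = 0"
  by (induction k) (simp_all only: funpow.simps o_apply id_apply wedge_zero_right)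

lemma wedge_funpow_commute:
  assumes "\<And>v. wedge x v = wedge v x"
  shows "wedge x ((wedge u ^^ k) v) = (wedge u ^^ k) (wedge x v)"
proof (induction k)
  case (Suc k)
  have "wedge x (wedge u v) = wedge u (wedge x v)" for v
    by (metis assms wedge_assoc)
  with Suc show ?case
    by simp
qed simp

text \<open>The binomial theorem for a central \<open>x\<close>: all terms with two or more factors
  \<open>x\<close> vanish.\<close>

lemma funpow_wedge_add_nilpotent:
  assumes comm: "\<And>v. wedge x v = wedge v x" and nil: "wedge x x = 0"
  shows "(wedge (u + x) ^^ Suc k) v =
    (wedge u ^^ Suc k) v + ext_scale (of_nat (Suc k)) (wedge x ((wedge u ^^ k) v))"
proof (induction k)
  case 0
  show ?case
    by (simp add: wedge_add_left del: plus_fun_apply)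
next
  case (Suc k)
  have xx: "wedge x (wedge x w) = 0" for w
    by (metis nil wedge_assoc wedge_zero_left)
  have xu: "wedge u (wedge x w) = wedge x (wedge u w)" for w
    by (metis comm wedge_assoc)
  have "(wedge (u + x) ^^ Suc (Suc k)) v = wedge (u + x) ((wedge (u + x) ^^ Suc k) v)"
    by simp
  also have "\<dots> = (wedge u ^^ Suc (Suc k)) v +
      (ext_scale (of_nat (Suc k)) (wedge x ((wedge u ^^ Suc k) v)) + wedge x ((wedge u ^^ Suc k) v))"
    unfolding Suc
    by (simp add: wedge_add_left wedge_add_right wedge_scale_right xx xu add_ac)
  also have "ext_scale (of_nat (Suc k)) (wedge x ((wedge u ^^ Suc k) v)) + wedge x ((wedge u ^^ Suc k) v) =
      ext_scale (of_nat (Suc (Suc k))) (wedge x ((wedge u ^^ Suc k) v))"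
    by (rule ext) (simp add: ext_scale_def algebra_simps)
  finally show ?case .
qed

lemma wedge_pair_form_rel_pow:
  assumes v: "v \<in> rel_pow P T r" and P: "\<And>D. D \<in> P \<Longrightarrow> card D = 2"
  shows "wedge (pair_form \<gamma> P) v \<in> rel_pow P T (r + 2)"
  unfolding rel_pow_def mem_Collect_eq
proof (intro allI impI)
  fix S
  assume "wedge (pair_form \<gamma> P) v S \<noteq> 0"
  then obtain D where D: "D \<subseteq> S" "finite S" "pair_form \<gamma> P D \<noteq> 0" "v (S - D) \<noteq> 0"
    by (rule wedge_nonzeroE)
  have "D \<in> P"
    using D(3) by (rule pair_form_nonzeroD)
  moreover have "card S = card (S - D) + card D"
    using D(1,2) by (metis card_Diff_subset card_mono finite_subset le_add_diff_inverse2)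
  ultimately show "finite S \<and> T \<subseteq> S \<and> S \<subseteq> T \<union> \<Union>P \<and> int (card S) = int (card T) + (r + 2)"
    using D(1,2) rel_powD[OF v D(4)] P[of D] by auto
qed

lemma funpow_wedge_pair_form_rel_pow:
  assumes "v \<in> rel_pow P T r" "\<And>D. D \<in> P \<Longrightarrow> card D = 2"
  shows "(wedge (pair_form \<gamma> P) ^^ k) v \<in> rel_pow P T (r + 2 * int k)"
proof (induction k)
  case (Suc k)
  show ?case
    using wedge_pair_form_rel_pow[OF Suc assms(2)] by (simp add: algebra_simps)
qed (use assms in simp)

section \<open>Splitting off a single pair\<close>

lemma wedge_single_pair:
  assumes "finite S"
  shows "wedge (pair_form \<gamma> {D}) v S = (if D \<subseteq> S then \<gamma> D * shuffle_sign D (S - D) * v (S - D) else 0)"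
proof -
  have "wedge (pair_form \<gamma> {D}) v S =
      (\<Sum>A\<in>Pow S. if A = D then \<gamma> D * shuffle_sign D (S - D) * v (S - D) else 0)"
    unfolding wedge_def pair_form_def by (intro sum.cong) auto
  then show ?thesis
    using assms by simp
qed

text \<open>The indices in \<open>A\<close> become prescribed, and the degree counts only indices
  that are not prescribed; hence it drops by \<open>card A\<close>.\<close>

lemma sector_rel_pow:
  assumes v: "v \<in> rel_pow (insert D P) T r" and "A \<subseteq> D" "D \<inter> T = {}"
  shows "sector D A v \<in> rel_pow P (T \<union> A) (r - int (card A))"
  unfolding rel_pow_def mem_Collect_eq
proof (intro allI impI)
  fix S
  assume "sector D A v S \<noteq> 0"
  then have S: "S \<inter> D = A" "v S \<noteq> 0"
    by (auto simp: sector_def split: if_splits)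
  note vD = rel_powD[OF v S(2)]
  have "card (T \<union> A) = card T + card A"
    using vD S assms by (intro card_Un_disjoint) (auto intro: finite_subset)
  then show "finite S \<and> T \<union> A \<subseteq> S \<and> S \<subseteq> T \<union> A \<union> \<Union>P \<and>
      int (card S) = int (card (T \<union> A)) + (r - int (card A))"
    using vD S assms by auto
qed

lemma sector_sector:
  assumes "u \<in> rel_pow P (T \<union> A) r" "A \<subseteq> D" "D \<inter> T = {}" "D \<inter> \<Union>P = {}"
  shows "sector D B u = (if A = B then u else 0)"
proof -
  have "S \<inter> D = A" if "u S \<noteq> 0" for S
    using rel_powD[OF assms(1) that] assms by blast
  then show ?thesis
    by (force simp: sector_def fun_eq_iff)
qed

lemma sector_add: "sector D A (u + v) = sector D A u + sector D A v"
  by (rule ext) (simp add: sector_def)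

lemma sector_zero: "sector D A 0 = 0"
  by (rule ext) (simp add: sector_def)

lemma sector_decomp:
  assumes "p \<noteq> q"
  shows "v = sector {p, q} {} v + sector {p, q} {p} v + sector {p, q} {q} v + sector {p, q} {p, q} v"
proof (rule ext)
  fix S
  have "S \<inter> {p, q} = {} \<or> S \<inter> {p, q} = {p} \<or> S \<inter> {p, q} = {q} \<or> S \<inter> {p, q} = {p, q}"
    by auto
  then show "v S = (sector {p, q} {} v + sector {p, q} {p} v + sector {p, q} {q} v + sector {p, q} {p, q} v) S"
    using assms by (elim disjE) (auto simp: sector_def doubleton_eq_iff)
qed

text \<open>The four summands lie in different sectors of \<open>{p, q}\<close>, so projecting the
  equation to each sector isolates one of them.\<close>

lemma sector_sum_eq_0:
  assumes "a + y + z + x = 0" and "p \<noteq> q"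
    and "a \<in> rel_pow P T r" "y \<in> rel_pow P (T \<union> {p}) s" "z \<in> rel_pow P (T \<union> {q}) t"
      "x \<in> rel_pow P (T \<union> {p, q}) r'"
    and "{p, q} \<inter> T = {}" "{p, q} \<inter> \<Union>P = {}"
  shows "a = 0" "y = 0" "z = 0" "x = 0"
proof -
  have eq: "sector {p, q} B a + sector {p, q} B y + sector {p, q} B z + sector {p, q} B x = 0" for B
    using arg_cong[OF assms(1), of "sector {p, q} B"] by (simp only: sector_add sector_zero)
  have a: "sector {p, q} B a = (if {} = B then a else 0)" for B
    using sector_sector[of a P T "{}" r "{p, q}" B] assms by simp
  have y: "sector {p, q} B y = (if {p} = B then y else 0)" for B
    using sector_sector[of y P T "{p}" s "{p, q}" B] assms by simp
  have z: "sector {p, q} B z = (if {q} = B then z else 0)" for B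
    using sector_sector[of z P T "{q}" t "{p, q}" B] assms by simp
  have x: "sector {p, q} B x = (if {p, q} = B then x else 0)" for B
    using sector_sector[of x P T "{p, q}" r' "{p, q}" B] assms by simp
  show "a = 0"
    using eq[of "{}"] unfolding a y z x by simp
  show "y = 0"
    using eq[of "{p}"] assms(2) unfolding a y z x by (simp add: doubleton_eq_iff)
  show "z = 0"
    using eq[of "{q}"] assms(2) unfolding a y z x by (simp add: doubleton_eq_iff)
  show "x = 0"
    using eq[of "{p, q}"] assms(2) unfolding a y z x by (simp add: doubleton_eq_iff)
qed

lemma wedge_single_pair_eq_0:
  assumes "u \<in> rel_pow P (T \<union> A) r" "A \<inter> D \<noteq> {}"
  shows "wedge (pair_form \<gamma> {D}) u = 0"
proof (rule ext)
  fix S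
  show "wedge (pair_form \<gamma> {D}) u S = 0 S"
  proof (rule ccontr)
    assume "wedge (pair_form \<gamma> {D}) u S \<noteq> 0 S"
    then have "wedge (pair_form \<gamma> {D}) u S \<noteq> 0"
      by simp
    then obtain B where "pair_form \<gamma> {D} B \<noteq> 0" "u (S - B) \<noteq> 0"
      by (rule wedge_nonzeroE)
    then have "u (S - D) \<noteq> 0"
      using pair_form_nonzeroD by blast
    with rel_powD(2)[OF assms(1)] assms(2) show False
      by blast
  qed
qed

text \<open>The pair joins the prescribed indices, so the relative degree stays \<open>r\<close>.
  Together with the next two lemmas, wedging with a fresh pair of nonzero coefficient is an
  isomorphism from \<open>rel_pow P T r\<close> to
  \<open>rel_pow P (T \<union> D) r\<close>.\<close>

lemma wedge_single_pair_rel_pow: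
  assumes u: "u \<in> rel_pow P T r" and D: "D \<inter> T = {}" "finite D"
  shows "wedge (pair_form \<gamma> {D}) u \<in> rel_pow P (T \<union> D) r"
  unfolding rel_pow_def mem_Collect_eq
proof (intro allI impI)
  fix S
  assume "wedge (pair_form \<gamma> {D}) u S \<noteq> 0"
  then obtain B where "B \<subseteq> S" "finite S" "pair_form \<gamma> {D} B \<noteq> 0" "u (S - B) \<noteq> 0"
    by (rule wedge_nonzeroE)
  then have S: "D \<subseteq> S" "finite S" "u (S - D) \<noteq> 0"
    using pair_form_nonzeroD by blast+
  note uS = rel_powD[OF u S(3)]
  have "finite T"
    using uS(1,2) finite_subset by blast
  then have "card (T \<union> D) = card T + card D"
    using D by (intro card_Un_disjoint) auto
  moreover have "card S = card (S - D) + card D"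
    using S(1,2) by (metis card_Diff_subset card_mono finite_subset le_add_diff_inverse2)
  ultimately show "finite S \<and> T \<union> D \<subseteq> S \<and> S \<subseteq> T \<union> D \<union> \<Union>P \<and>
      int (card S) = int (card (T \<union> D)) + r"
    using S uS by auto
qed

lemma wedge_single_pair_inj:
  assumes u: "u \<in> rel_pow P T r" and D: "D \<inter> T = {}" "D \<inter> \<Union>P = {}" "finite D" "\<gamma> D \<noteq> 0"
    and 0: "wedge (pair_form \<gamma> {D}) u = 0"
  shows "u = 0"
proof (rule ext, rule ccontr)
  fix S
  assume "u S \<noteq> 0 S"
  then have S: "u S \<noteq> 0"
    by simp
  have "(S \<union> D) - D = S" "finite (S \<union> D)"
    using rel_powD[OF u S] D by blast+
  then have "wedge (pair_form \<gamma> {D}) u (S \<union> D) \<noteq> 0"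
    using S D(4) by (simp add: wedge_single_pair)
  with 0 show False
    by simp
qed

lemma wedge_single_pair_surj:
  assumes w: "w \<in> rel_pow P (T \<union> D) r" and D: "D \<inter> T = {}" "D \<inter> \<Union>P = {}" "finite D" "\<gamma> D \<noteq> 0"
    and T: "finite T"
  shows "\<exists>u \<in> rel_pow P T r. wedge (pair_form \<gamma> {D}) u = w"
proof
  \<comment> \<open>Contraction with the pair: strip \<open>D\<close> from each index set and divide
    by the coefficient that wedging reintroduces.\<close>
  define u :: ext where "u = (\<lambda>S. if S \<inter> D = {} then w (S \<union> D) / (\<gamma> D * shuffle_sign D S) else 0)"
  show "u \<in> rel_pow P T r"
    unfolding rel_pow_def mem_Collect_eq
  proof (intro allI impI)
    fix S
    assume "u S \<noteq> 0"
    then have S: "S \<inter> D = {}" "w (S \<union> D) \<noteq> 0"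
      by (auto simp: u_def split: if_splits)
    note wS = rel_powD[OF w S(2)]
    have "card (T \<union> D) = card T + card D" "card (S \<union> D) = card S + card D"
      using D T S wS(1) by (auto intro!: card_Un_disjoint)
    then show "finite S \<and> T \<subseteq> S \<and> S \<subseteq> T \<union> \<Union>P \<and> int (card S) = int (card T) + r"
      using wS D S by auto
  qed
  show "wedge (pair_form \<gamma> {D}) u = w"
  proof (rule ext)
    fix S
    show "wedge (pair_form \<gamma> {D}) u S = w S"
    proof (cases "finite S \<and> D \<subseteq> S")
      case True
      then have "(S - D) \<union> D = S" "(S - D) \<inter> D = {}"
        by auto
      then show ?thesis
        using True D by (simp add: wedge_single_pair u_def)
    next
      case False
      have "wedge (pair_form \<gamma> {D}) u S = 0"
      proof (cases "finite S")
        case True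
        then show ?thesis
          using False by (simp add: wedge_single_pair)
      qed (auto elim: wedge_nonzeroE intro: ccontr)
      moreover have "w S = 0"
        using rel_powD[OF w, of S] False by blast
      ultimately show ?thesis
        by simp
    qed
  qed
qed

text \<open>Converse bookkeeping to \<open>sector_rel_pow\<close>: the prescribed indices
  \<open>A\<close> are counted in the degree again.\<close>

lemma rel_pow_lift:
  assumes v: "v \<in> rel_pow P (T \<union> A) s" and "A \<subseteq> D" "A \<inter> T = {}" and r: "r = s + int (card A)"
  shows "v \<in> rel_pow (insert D P) T r"
  unfolding rel_pow_def mem_Collect_eq
proof (intro allI impI)
  fix S
  assume S: "v S \<noteq> 0"
  note vS = rel_powD[OF v S]
  have "finite (T \<union> A)"
    using vS(1,2) finite_subset by blast
  then have "card (T \<union> A) = card T + card A"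
    using assms by (intro card_Un_disjoint) auto
  then show "finite S \<and> T \<subseteq> S \<and> S \<subseteq> T \<union> \<Union>(insert D P) \<and> int (card S) = int (card T) + r"
    using vS assms by auto
qed

lemma wedge_single_pair_self:
  assumes "D \<noteq> {}"
  shows "wedge (pair_form \<gamma> {D}) (pair_form \<gamma> {D}) = 0"
proof (rule ext, rule ccontr)
  fix S
  assume "wedge (pair_form \<gamma> {D}) (pair_form \<gamma> {D}) S \<noteq> 0 S"
  then have "wedge (pair_form \<gamma> {D}) (pair_form \<gamma> {D}) S \<noteq> 0"
    by simp
  then obtain B where "pair_form \<gamma> {D} B \<noteq> 0" "pair_form \<gamma> {D} (S - B) \<noteq> 0"
    by (rule wedge_nonzeroE)
  then have "S - D = D"
    by (metis pair_form_nonzeroD singletonD)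
  with assms show False
    by blast
qed

text \<open>The induction adds one pair \<open>{p, q}\<close>, with bivector \<open>x\<close>. Since \<open>x\<^sup>2 = 0\<close>,
  \<open>(\<omega> + x)\<^sup>k = \<omega>\<^sup>k + k x \<omega>\<^sup>k\<^sup>-\<^sup>1\<close>, and a vector \<open>a + y + z + x e\<close>, with \<open>y\<close> and \<open>z\<close> containing only
  \<open>e\<^sub>p\<close> and only \<open>e\<^sub>q\<close>, is mapped to \<open>\<omega>\<^sup>k a + \<omega>\<^sup>k y + \<omega>\<^sup>k z + x (\<omega>\<^sup>k e + k \<omega>\<^sup>k\<^sup>-\<^sup>1 a)\<close>.
  The degrees of \<open>a\<close>, \<open>y\<close>, \<open>z\<close>, \<open>e\<close> are those of the induction hypothesis for the exponents
  \<open>k-1\<close>, \<open>k\<close>, \<open>k\<close>, \<open>k+1\<close>; applying \<open>\<omega>\<close> to the last component decouples \<open>e\<close> from \<open>a\<close>.\<close>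

lemma hard_lefschetz:
  assumes "finite P" "\<And>D. D \<in> P \<Longrightarrow> card D = 2 \<and> \<gamma> D \<noteq> 0" "pairwise disjnt P"
    and "finite T" "T \<inter> \<Union>P = {}"
  shows "(\<forall>v \<in> rel_pow P T (int (card P) - int k). (wedge (pair_form \<gamma> P) ^^ k) v = 0 \<longrightarrow> v = 0) \<and>
    (\<forall>w \<in> rel_pow P T (int (card P) + int k).
       \<exists>v \<in> rel_pow P T (int (card P) - int k). (wedge (pair_form \<gamma> P) ^^ k) v = w)"
  using assms
proof (induction P arbitrary: T k rule: finite_induct)
  case empty
  \<comment> \<open>Without pairs only \<open>S = T\<close> can carry a coefficient, so the space is
    zero outside degree \<open>0\<close>. For \<open>k > 0\<close> source and target are both
    zero.\<close>
  have zero: "v = 0" if v: "v \<in> rel_pow {} T r" and "r \<noteq> 0" for v r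
  proof (rule ext, rule ccontr)
    fix S
    assume "v S \<noteq> 0 S"
    then have S: "v S \<noteq> 0"
      by simp
    then have "S = T"
      using rel_powD(2,3)[OF v S] by blast
    then show False
      using rel_powD(4)[OF v S] \<open>r \<noteq> 0\<close> by simp
  qed
  show ?case
  proof (cases "k = 0")
    case False
    then have "v = 0" if "v \<in> rel_pow {} T (int k) \<or> v \<in> rel_pow {} T (- int k)" for v
      using that zero[of v] by fastforce
    then show ?thesis
      by (metis card.empty diff_0 funpow_wedge_zero of_nat_0 add_0 rel_pow_zero)
  qed simp
next
  case (insert D P)
  obtain p q where D: "D = {p, q}" "p \<noteq> q"
    using insert.prems(1) by (metis card_2_iff insertI1)
  have Dsub: "D \<inter> T = {}" "D \<inter> \<Union>P = {}" "finite D" "\<gamma> D \<noteq> 0" "card D = 2"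
    using insert D by (auto simp: pairwise_insert disjnt_def)
  have P: "\<And>D. D \<in> P \<Longrightarrow> card D = 2 \<and> \<gamma> D \<noteq> 0" "pairwise disjnt P" "T \<inter> \<Union>P = {}" "finite T"
    using insert.prems by (auto simp: pairwise_insert)
  have cP: "\<And>D. D \<in> P \<Longrightarrow> card D = 2"
    using P(1) by blast
  let ?n = "int (card P)"
  define L where "L = wedge (pair_form \<gamma> P)"
  define X where "X = wedge (pair_form \<gamma> {D})"
  have TA: "finite (T \<union> A)" "(T \<union> A) \<inter> \<Union>P = {}" if "A \<subseteq> D" for A
    using that P Dsub finite_subset[OF that] by auto
  \<comment> \<open>Generality in \<open>T\<close> and in the exponent is essential: the sets
    \<open>T\<close>, \<open>T \<union> {p}\<close>, \<open>T \<union> {q}\<close> and three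
    consecutive exponents all occur below.\<close>
  have IH: "(\<forall>v \<in> rel_pow P (T \<union> A) (?n - int j). (L ^^ j) v = 0 \<longrightarrow> v = 0) \<and>
      (\<forall>w \<in> rel_pow P (T \<union> A) (?n + int j). \<exists>v \<in> rel_pow P (T \<union> A) (?n - int j). (L ^^ j) v = w)"
    if "A \<subseteq> D" for A j
    unfolding L_def by (rule insert.IH) (fact P(1) P(2) TA(1)[OF that] TA(2)[OF that])+
  have inj: "v = 0" if "v \<in> rel_pow P (T \<union> A) (?n - int j)" "(L ^^ j) v = 0" "A \<subseteq> D" for A v j
    using IH[OF that(3), of j] that(1,2) by simp
  have surj: "\<exists>v \<in> rel_pow P (T \<union> A) (?n - int j). (L ^^ j) v = w"
    if "w \<in> rel_pow P (T \<union> A) (?n + int j)" "A \<subseteq> D" for A w j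
    using IH[OF that(2), of j] that(1) by simp
  have L_pow: "(L ^^ j) v \<in> rel_pow P T' (r + 2 * int j)" if "v \<in> rel_pow P T' r" for v T' r j
    unfolding L_def by (rule funpow_wedge_pair_form_rel_pow[OF that cP])
  have L_pow': "(L ^^ j) v \<in> rel_pow P T' s" if "v \<in> rel_pow P T' r" "s = r + 2 * int j" for v T' r s j
    using L_pow[OF that(1), of j] that(2) by simp
  have L_add: "(L ^^ j) (u + v) = (L ^^ j) u + (L ^^ j) v" for u v j
    unfolding L_def by (rule funpow_wedge_add)
  have L_scale: "(L ^^ j) (ext_scale c u) = ext_scale c ((L ^^ j) u)" for u c j
    unfolding L_def by (rule funpow_wedge_scale)
  have X_add: "X (u + v) = X u + X v" for u v
    unfolding X_def by (rule wedge_add_right)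
  have X_scale: "X (ext_scale c u) = ext_scale c (X u)" for u c
    unfolding X_def by (rule wedge_scale_right)
  have even: "wedge (pair_form \<gamma> {D}) v = wedge v (pair_form \<gamma> {D})" for v
    by (rule wedge_even_commute) (use Dsub in \<open>auto dest!: pair_form_nonzeroD\<close>)
  have XL: "X ((L ^^ j) v) = (L ^^ j) (X v)" for v j
    unfolding X_def L_def by (rule wedge_funpow_commute[OF even])
  show ?case
  proof (cases k)
    case 0
    then show ?thesis
      by simp
  next
    case (Suc j)
    define c :: complex where "c = of_nat (Suc j)"
    have c: "c \<noteq> 0"
      unfolding c_def using of_nat_neq_0 by blast
    define M where "M = wedge (pair_form \<gamma> (insert D P)) ^^ Suc j"
    have M: "M v = (L ^^ Suc j) v + ext_scale c (X ((L ^^ j) v))" for v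
      unfolding M_def L_def X_def c_def pair_form_insert[OF insert.hyps(2)]
      by (rule funpow_wedge_add_nilpotent[OF even wedge_single_pair_self]) (use D in blast)
    have M_add: "M (u + v) = M u + M v" for u v
      unfolding M_def by (rule funpow_wedge_add)
    have M_single: "M y = (L ^^ Suc j) y"
      if "y \<in> rel_pow P (T \<union> A) s" "A \<inter> D \<noteq> {}" for y A s
      using wedge_single_pair_eq_0[OF L_pow[OF that(1)] that(2)] by (simp add: M X_def)
    have XD: "X e \<in> rel_pow P (T \<union> D) s" if "e \<in> rel_pow P T s" for e s
      unfolding X_def by (rule wedge_single_pair_rel_pow) (use that Dsub in auto)
    have M_X: "M (X e) = X ((L ^^ Suc j) e)" if "e \<in> rel_pow P T s" for e s
      unfolding XL by (rule M_single[OF XD[OF that]]) (use D in auto)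
    have M_sum: "M (a + y + z + X e) = (L ^^ Suc j) a + (L ^^ Suc j) y + (L ^^ Suc j) z +
        X (ext_scale c ((L ^^ j) a) + (L ^^ Suc j) e)"
      if "y \<in> rel_pow P (T \<union> {p}) s" "z \<in> rel_pow P (T \<union> {q}) t" "e \<in> rel_pow P T r"
      for a y z e r s t
    proof -
      have "M y = (L ^^ Suc j) y" "M z = (L ^^ Suc j) z"
        using M_single[OF that(1)] M_single[OF that(2)] D by blast+
      then show ?thesis
        unfolding M_add M_X[OF that(3)] M[of a] X_add X_scale by (simp only: add_ac)
    qed
    \<comment> \<open>The fourth component contains both \<open>p\<close> and \<open>q\<close>; it
      is divided by the bivector of the pair, so \<open>e\<close> has degree \<open>r - 2\<close>
      over the same \<open>T\<close>.\<close>
    have split: "\<exists>a y z e. a \<in> rel_pow P T r \<and> y \<in> rel_pow P (T \<union> {p}) (r - 1) \<and>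
        z \<in> rel_pow P (T \<union> {q}) (r - 1) \<and> e \<in> rel_pow P T (r - 2) \<and> v = a + y + z + X e"
      if "v \<in> rel_pow (insert D P) T r" for v r
    proof -
      note sec = sector_rel_pow[OF that _ Dsub(1)]
      have sD: "sector D D v \<in> rel_pow P (T \<union> D) (r - 2)"
        using sec[of D] Dsub by simp
      obtain e where "e \<in> rel_pow P T (r - 2)" "X e = sector D D v"
        unfolding X_def using wedge_single_pair_surj[where \<gamma> = \<gamma>, OF sD Dsub(1-4) P(4)] by blast
      moreover have "v = sector D {} v + sector D {p} v + sector D {q} v + sector D D v"
        unfolding D(1) by (rule sector_decomp[OF D(2)])
      ultimately show ?thesis
        using sec[of "{}"] sec[of "{p}"] sec[of "{q}"] D by force
    qed
    have ker: "v = 0" if v: "v \<in> rel_pow (insert D P) T (?n - int j)" and 0: "M v = 0" for v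
    proof -
      obtain a y z e where ay: "a \<in> rel_pow P T (?n - int j)" "y \<in> rel_pow P (T \<union> {p}) (?n - int j - 1)"
        "z \<in> rel_pow P (T \<union> {q}) (?n - int j - 1)" "e \<in> rel_pow P T (?n - int j - 2)"
        "v = a + y + z + X e"
        using split[OF v] by blast
      \<comment> \<open>The cofactor of the new pair in \<open>M v\<close>. Both summands have
        degree \<open>?n + int j\<close>.\<close>
      define f where "f = ext_scale c ((L ^^ j) a) + (L ^^ Suc j) e"
      have f: "f \<in> rel_pow P T (?n + int j)"
        unfolding f_def by (intro rel_pow_add rel_pow_scale L_pow'[OF ay(1)] L_pow'[OF ay(4)]) auto
      have "(L ^^ Suc j) a + (L ^^ Suc j) y + (L ^^ Suc j) z + X f = 0"
        using 0 unfolding ay(5) f_def by (subst (asm) M_sum[OF ay(2-4)])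
      note zero = sector_sum_eq_0[OF this D(2) L_pow[OF ay(1)] L_pow[OF ay(2)] L_pow[OF ay(3)]
          XD[OF f, unfolded D(1)] Dsub(1,2)[unfolded D(1)]]
      have y: "y = 0"
        by (rule inj[of y "{p}" "Suc j"]) (use ay D zero in \<open>auto simp: algebra_simps\<close>)
      have z: "z = 0"
        by (rule inj[of z "{q}" "Suc j"]) (use ay D zero in \<open>auto simp: algebra_simps\<close>)
      have f0: "f = 0"
        using wedge_single_pair_inj[where \<gamma> = \<gamma>, OF f Dsub(1-4)] zero(4) unfolding X_def by blast
      \<comment> \<open>Applying \<open>L\<close> once more turns the \<open>a\<close>-term into
        \<open>L ^^ Suc j\<close> of \<open>a\<close>, already known to vanish. This leaves an
        equation for \<open>e\<close> alone, in the degree where \<open>L ^^ Suc (Suc j)\<close> is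
        injective.\<close>
      have "L f = ext_scale c ((L ^^ Suc j) a) + (L ^^ Suc (Suc j)) e"
        using L_add[of 1] L_scale[of 1] unfolding f_def by simp
      then have "(L ^^ Suc (Suc j)) e = 0"
        unfolding f0 zero(1) by (simp add: L_def)
      then have e: "e = 0"
        by (intro inj[of e "{}" "Suc (Suc j)"]) (use ay in \<open>auto simp: algebra_simps\<close>)
      have "ext_scale c ((L ^^ j) a) = 0"
        using f0 unfolding f_def e L_def by simp
      then have "(L ^^ j) a = 0"
        using c by (simp add: ext_scale_def fun_eq_iff)
      then have "a = 0"
        by (intro inj[of a "{}" j]) (use ay in auto)
      then show ?thesis
        using y z e ay(5) by (simp add: X_def)
    qed
    have onto: "\<exists>v \<in> rel_pow (insert D P) T (?n - int j). M v = w"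
      if w: "w \<in> rel_pow (insert D P) T (?n + int j + 2)" for w
    proof -
      obtain a y z f where ay: "a \<in> rel_pow P T (?n + int j + 2)" "y \<in> rel_pow P (T \<union> {p}) (?n + int j + 2 - 1)"
        "z \<in> rel_pow P (T \<union> {q}) (?n + int j + 2 - 1)" "f \<in> rel_pow P T (?n + int j + 2 - 2)"
        "w = a + y + z + X f"
        using split[OF w] by blast
      obtain y' where y': "y' \<in> rel_pow P (T \<union> {p}) (?n - int (Suc j))" "(L ^^ Suc j) y' = y"
        using surj[of y "{p}" "Suc j"] ay D by (auto simp: algebra_simps)
      obtain z' where z': "z' \<in> rel_pow P (T \<union> {q}) (?n - int (Suc j))" "(L ^^ Suc j) z' = z"
        using surj[of z "{q}" "Suc j"] ay D by (auto simp: algebra_simps)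
      \<comment> \<open>The unknowns must satisfy \<open>L\<^sup>j\<^sup>+\<^sup>1 a' = a\<close>
        and \<open>c L\<^sup>j a' + L\<^sup>j\<^sup>+\<^sup>1 e = f\<close>. Applying
        \<open>L\<close> to the second equation eliminates \<open>a'\<close>; the result is solved
        for \<open>e\<close> first.\<close>
      have "(L ^^ 1) f + ext_scale (- c) a \<in> rel_pow P T (?n + int (Suc (Suc j)))"
        by (intro rel_pow_add rel_pow_scale L_pow'[OF ay(4)])
          (use ay(1) in \<open>auto simp: algebra_simps\<close>)
      then obtain e where e: "e \<in> rel_pow P T (?n - int (Suc (Suc j)))"
        "(L ^^ Suc (Suc j)) e = L f + ext_scale (- c) a"
        using surj[of _ "{}" "Suc (Suc j)"] by fastforce
      \<comment> \<open>The value that the second equation forces on \<open>L\<^sup>j a'\<close>.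
        The choice of \<open>e\<close> makes \<open>L h = a\<close>, so the first equation then
        holds automatically.\<close>
      define h where "h = ext_scale (1 / c) (f + ext_scale (- 1) ((L ^^ Suc j) e))"
      have "h \<in> rel_pow P T (?n + int j)"
        unfolding h_def by (intro rel_pow_add rel_pow_scale L_pow'[OF e(1)]) (use ay(4) in auto)
      then obtain a' where a': "a' \<in> rel_pow P T (?n - int j)" "(L ^^ j) a' = h"
        using surj[of h "{}" j] by auto
      have "(L ^^ Suc j) a' = L h"
        using a'(2) by simp
      also have "\<dots> = ext_scale (1 / c) (L f + ext_scale (- 1) ((L ^^ Suc (Suc j)) e))"
        using L_add[of 1] L_scale[of 1] unfolding h_def by simp
      also have "\<dots> = a"
        unfolding e(2) using c by (simp add: ext_scale_def fun_eq_iff field_simps)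
      finally have La: "(L ^^ Suc j) a' = a" .
      have "ext_scale c ((L ^^ j) a') + (L ^^ Suc j) e = f"
        unfolding a'(2) h_def using c by (simp add: ext_scale_def fun_eq_iff)
      then have "M (a' + y' + z' + X e) = w"
        using M_sum[OF y'(1) z'(1) e(1), of a'] y'(2) z'(2) La ay(5) by simp
      moreover have "a' + y' + z' + X e \<in> rel_pow (insert D P) T (?n - int j)"
      proof (intro rel_pow_add)
        show "a' \<in> rel_pow (insert D P) T (?n - int j)"
          by (rule rel_pow_lift[where A = "{}"]) (use a' in auto)
        show "y' \<in> rel_pow (insert D P) T (?n - int j)"
          by (rule rel_pow_lift[OF y'(1)]) (use D Dsub in auto)
        show "z' \<in> rel_pow (insert D P) T (?n - int j)"
          by (rule rel_pow_lift[OF z'(1)]) (use D Dsub in auto)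
        show "X e \<in> rel_pow (insert D P) T (?n - int j)"
          by (rule rel_pow_lift[OF XD[OF e(1)]]) (use Dsub in auto)
      qed
      ultimately show ?thesis
        by blast
    qed
    \<comment> \<open>Adding the pair raises the middle degree by one and \<open>k = Suc j\<close>:
      the shifts cancel in the source and add up to \<open>2\<close> in the target.\<close>
    have deg: "int (card (insert D P)) - int k = ?n - int j" "int (card (insert D P)) + int k = ?n + int j + 2"
      using insert.hyps Suc by auto
    have M_eq: "wedge (pair_form \<gamma> (insert D P)) ^^ k = M"
      by (simp only: M_def Suc)
    show ?thesis
      unfolding deg M_eq by (intro conjI ballI impI) (rule ker onto; assumption)+
  qed
qed

subsection \<open>The Cayley form\<close>

text \<open>The Levi-Civita symbol, that is, the alternating form on
  \<open>\<complex>\<^sup>2\<close> which a matrix scales by its determinant.\<close>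

definition eps :: "2 \<Rightarrow> 2 \<Rightarrow> complex" where
  "eps a b = (if a = b then 0 else if a = 1 then 1 else -1)"

lemma permutations_2: "{p. p permutes (UNIV :: 2 set)} = {id, Transposition.transpose 1 2}"
  unfolding UNIV_2 by (auto simp: permutes_doubleton_iff)

text \<open>The sum is the determinant of the matrix formed by rows \<open>a\<close> and
  \<open>b\<close> of \<open>A\<close>, hence alternating in the two rows.\<close>

lemma sum_permutations_2:
  fixes A :: "complex^2^2"
  shows "(\<Sum>p | p permutes (UNIV :: 2 set). of_int (sign p) * A $ a $ p 1 * A $ b $ p 2) = det A * eps a b"
proof -
  have "id \<noteq> Transposition.transpose (1::2) 2"
    by (simp add: fun_eq_iff exI[of _ 1])
  then have "(\<Sum>p | p permutes (UNIV :: 2 set). of_int (sign p) * A $ a $ p 1 * A $ b $ p 2) =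
      A $ a $ 1 * A $ b $ 2 - A $ a $ 2 * A $ b $ 1"
    unfolding permutations_2 by (simp add: sign_swap_id sign_id)
  then show ?thesis
    using exhaust_2[of a] exhaust_2[of b] by (auto simp: det_2 eps_def)
qed

text \<open>The left side is the Cayley form with \<open>g\<close> applied to every vector. Stated
  for general \<open>g\<close>, one computation yields both the coordinates of \<omega> (identity
  matrices) and its behaviour under the group.\<close>

lemma cayley_bivector:
  fixes g :: "nat \<Rightarrow> complex^2^2"
  shows "(\<Sum>\<pi>\<in>PiE {..<d} (\<lambda>_. {p. p permutes (UNIV :: 2 set)}).
      ext_scale (of_int (\<Prod>j<d. sign (\<pi> j)))
        (wedge (ext_incl (act_basis d g (map (\<lambda>j. \<pi> j 1) [0..<d])))
               (ext_incl (act_basis d g (map (\<lambda>j. \<pi> j 2) [0..<d]))))) =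
    ext_scale (\<Prod>j<d. det (g j))
      (\<Sum>u\<in>words d. \<Sum>v\<in>words d. ext_scale (\<Prod>j<d. eps (u ! j) (v ! j))
        (wedge (ext_incl (\<lambda>w. if w = u then 1 else 0)) (ext_incl (\<lambda>w. if w = v then 1 else 0))))"
    (is "(\<Sum>\<pi>\<in>?\<Pi>. ext_scale (?s \<pi>) (wedge (ext_incl (?x \<pi>)) (ext_incl (?y \<pi>)))) = _")
proof -
  let ?e = "\<lambda>u. ext_incl (\<lambda>w. if w = u then 1 else 0)"
  have word: "map f [0..<d] \<in> words d" for f
    by (simp add: words_def)
  have exp: "ext_incl (act_basis d g w) = (\<Sum>u\<in>words d. ext_scale (act_basis d g w u) (?e u))"
    if "w \<in> words d" for w
    by (rule ext_incl_expand) (use that in \<open>auto simp: act_basis_apply split: if_splits\<close>)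
  have coeff: "(\<Sum>\<pi>\<in>?\<Pi>. ?s \<pi> * ?x \<pi> u * ?y \<pi> v) = (\<Prod>j<d. det (g j)) * (\<Prod>j<d. eps (u ! j) (v ! j))"
    if uv: "u \<in> words d" "v \<in> words d" for u v
  proof -
    have "(\<Sum>\<pi>\<in>?\<Pi>. ?s \<pi> * ?x \<pi> u * ?y \<pi> v) =
        (\<Sum>\<pi>\<in>?\<Pi>. \<Prod>j<d. of_int (sign (\<pi> j)) * g j $ (u ! j) $ \<pi> j 1 * g j $ (v ! j) $ \<pi> j 2)"
      using uv by (simp add: act_basis_apply[OF word] prod.distrib)
    \<comment> \<open>The permutations of the tensor factors are chosen independently, so the sum
      factorises into \<open>d\<close> determinants of size two.\<close>
    also have "\<dots> = (\<Prod>j<d. \<Sum>p | p permutes (UNIV :: 2 set).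
        of_int (sign p) * g j $ (u ! j) $ p 1 * g j $ (v ! j) $ p 2)"
      by (rule prod_sum_PiE[symmetric]) (auto simp: permutations_2)
    finally show ?thesis
      by (simp add: sum_permutations_2 prod.distrib)
  qed
  show ?thesis
  proof (rule ext)
    fix S
    have "(\<Sum>\<pi>\<in>?\<Pi>. ext_scale (?s \<pi>) (wedge (ext_incl (?x \<pi>)) (ext_incl (?y \<pi>)))) S =
        (\<Sum>\<pi>\<in>?\<Pi>. \<Sum>u\<in>words d. \<Sum>v\<in>words d. ?s \<pi> * ?x \<pi> u * ?y \<pi> v * wedge (?e u) (?e v) S)"
      unfolding exp[OF word] wedge_sum_left wedge_scale_left
      unfolding wedge_sum_right wedge_scale_right
      by (simp add: sum_fun_apply ext_scale_def sum_distrib_left mult.assoc)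
    also have "\<dots> = (\<Sum>u\<in>words d. \<Sum>\<pi>\<in>?\<Pi>. \<Sum>v\<in>words d. ?s \<pi> * ?x \<pi> u * ?y \<pi> v * wedge (?e u) (?e v) S)"
      by (rule sum.swap)
    also have "\<dots> = (\<Sum>u\<in>words d. \<Sum>v\<in>words d. (\<Sum>\<pi>\<in>?\<Pi>. ?s \<pi> * ?x \<pi> u * ?y \<pi> v) * wedge (?e u) (?e v) S)"
      unfolding sum_distrib_right by (intro sum.cong refl sum.swap)
    also have "\<dots> = (\<Sum>u\<in>words d. \<Sum>v\<in>words d.
        (\<Prod>j<d. det (g j)) * (\<Prod>j<d. eps (u ! j) (v ! j)) * wedge (?e u) (?e v) S)"
      by (intro sum.cong refl) (simp only: coeff)
    finally show "(\<Sum>\<pi>\<in>?\<Pi>. ext_scale (?s \<pi>) (wedge (ext_incl (?x \<pi>)) (ext_incl (?y \<pi>)))) S =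
        ext_scale (\<Prod>j<d. det (g j))
          (\<Sum>u\<in>words d. \<Sum>v\<in>words d. ext_scale (\<Prod>j<d. eps (u ! j) (v ! j)) (wedge (?e u) (?e v))) S"
      by (simp add: sum_fun_apply ext_scale_def sum_distrib_left mult.assoc)
  qed
qed

lemma act_basis_id:
  assumes "w \<in> words d"
  shows "act_basis d (\<lambda>_. mat 1) w = (\<lambda>u. if u = w then 1 else 0)"
proof -
  have "tensor_act d (\<lambda>_. mat 1) (pure_tensor d (\<lambda>j. axis (w ! j) 1)) u =
      (\<Sum>v\<in>words d. if v = w then if u = v then 1 else 0 else 0)" for u
    unfolding tensor_act_def sum_fun_apply pure_tensor_word[OF assms]
    by (intro sum.cong) (auto simp: tensor_scale_def pure_tensor_word)
  then show ?thesis
    using assms by (simp add: act_basis_def fun_eq_iff)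
qed

lemma cayley_expand:
  "cayley d = (\<Sum>u\<in>words d. \<Sum>v\<in>words d. ext_scale (\<Prod>j<d. eps (u ! j) (v ! j))
    (wedge (ext_incl (\<lambda>w. if w = u then 1 else 0)) (ext_incl (\<lambda>w. if w = v then 1 else 0))))"
proof -
  have "act_basis d (\<lambda>_. mat 1) (map f [0..<d]) = pure_tensor d (\<lambda>j. axis (f j) 1)" for f
    unfolding pure_tensor_axis by (rule act_basis_id) (simp add: words_def)
  then show ?thesis
    using cayley_bivector[of d "\<lambda>_. mat 1"] by (simp add: cayley_def)
qed

lemma ext_act_cayley: "ext_act d g (cayley d) = ext_scale (\<Prod>j<d. det (g j)) (cayley d)"
proof -
  have "ext_act d g (ext_incl (pure_tensor d (\<lambda>j. axis (f j) 1))) =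
      ext_incl (act_basis d g (map f [0..<d]))" for f
    unfolding pure_tensor_axis by (rule ext_act_incl_word) (simp add: words_def)
  then have "ext_act d g (cayley d) = (\<Sum>\<pi>\<in>PiE {..<d} (\<lambda>_. {p. p permutes (UNIV :: 2 set)}).
      ext_scale (of_int (\<Prod>j<d. sign (\<pi> j)))
        (wedge (ext_incl (act_basis d g (map (\<lambda>j. \<pi> j 1) [0..<d])))
               (ext_incl (act_basis d g (map (\<lambda>j. \<pi> j 2) [0..<d])))))"
    by (simp add: cayley_def ext_act_sum ext_act_scale ext_act_wedge)
  then show ?thesis
    unfolding cayley_expand cayley_bivector .
qed

text \<open>Arithmetic in the type \<open>2\<close> is modulo \<open>2\<close>, so adding
  \<open>1\<close> exchanges the two letters: this is the complementary word.\<close>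

definition flip :: "word \<Rightarrow> word" where
  "flip w = map (\<lambda>i. i + 1) w"

lemma flip_2 [simp]: "i + 1 + 1 = (i::2)"
  using exhaust_2[of i] by auto

lemma flip_flip [simp]: "flip (flip w) = w"
  by (simp add: flip_def o_def)

lemma flip_eq_iff [simp]: "flip u = flip v \<longleftrightarrow> u = v"
  by (metis flip_flip)

lemma flip_in_words [simp]: "flip w \<in> words d \<longleftrightarrow> w \<in> words d"
  by (simp add: flip_def words_def)

lemma flip_neq:
  assumes "w \<in> words d" "d > 0"
  shows "flip w \<noteq> w"
proof
  assume "flip w = w"
  moreover have "flip w ! 0 = w ! 0 + 1"
    using assms by (simp add: flip_def words_def)
  ultimately show False
    by simp
qed

lemma eps_eq_0_iff: "eps a b = 0 \<longleftrightarrow> b \<noteq> a + 1"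
  using exhaust_2[of a] exhaust_2[of b] by (auto simp: eps_def)

lemma prod_eps_nonzero_iff:
  assumes "u \<in> words d" "v \<in> words d"
  shows "(\<Prod>j<d. eps (u ! j) (v ! j)) \<noteq> 0 \<longleftrightarrow> v = flip u"
  using assms by (auto simp: eps_eq_0_iff list_eq_iff_nth_eq flip_def words_def)

lemma eps_swap: "eps b a = - eps a b"
  using exhaust_2[of a] exhaust_2[of b] by (auto simp: eps_def)

lemma wedge_incl_words:
  "wedge (ext_incl (\<lambda>w. if w = u then 1 else 0)) (ext_incl (\<lambda>w. if w = v then 1 else 0)) S =
    (if u \<noteq> v \<and> S = {u, v} then shuffle_sign {u} {v} else 0)"
proof -
  have *: "ext_incl (\<lambda>u. if u = w then 1 else 0) S = (if S = {w} then 1 else 0)" for w S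
    by (auto simp: ext_incl_def is_singleton_def)
  have "wedge (ext_incl (\<lambda>w. if w = u then 1 else 0)) (ext_incl (\<lambda>w. if w = v then 1 else 0)) S =
      (\<Sum>A\<in>Pow S. if A = {u} then if S - {u} = {v} then shuffle_sign {u} {v} else 0 else 0)"
    unfolding wedge_def * by (intro sum.cong) auto
  also have "\<dots> = (if {u} \<subseteq> S \<and> S - {u} = {v} then shuffle_sign {u} {v} else 0)"
  proof (cases "finite S")
    case False
    then have "S - {u} \<noteq> {v}"
      by (metis finite.emptyI finite_Diff_insert finite_insert Diff_empty)
    with False show ?thesis
      by simp
  qed simp
  also have "{u} \<subseteq> S \<and> S - {u} = {v} \<longleftrightarrow> u \<noteq> v \<and> S = {u, v}"
    by auto
  finally show ?thesis .
qed

lemma cayley_apply: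
  "cayley d S = (\<Sum>u\<in>words d. if u \<noteq> flip u \<and> S = {u, flip u}
     then (\<Prod>j<d. eps (u ! j) (flip u ! j)) * shuffle_sign {u} {flip u} else 0)"
proof -
  have "cayley d S = (\<Sum>u\<in>words d. \<Sum>v\<in>words d. if v = flip u then
      (if u \<noteq> v \<and> S = {u, v} then (\<Prod>j<d. eps (u ! j) (v ! j)) * shuffle_sign {u} {v} else 0) else 0)"
    unfolding cayley_expand sum_fun_apply ext_scale_def wedge_incl_words
  proof (intro sum.cong refl)
    fix u v assume uv: "u \<in> words d" "v \<in> words d"
    show "(\<Prod>j<d. eps (u ! j) (v ! j)) * (if u \<noteq> v \<and> S = {u, v} then shuffle_sign {u} {v} else 0) =
        (if v = flip u then if u \<noteq> v \<and> S = {u, v} then (\<Prod>j<d. eps (u ! j) (v ! j)) * shuffle_sign {u} {v}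
         else 0 else 0)"
    proof (cases "v = flip u")
      case False
      then have "(\<Prod>j<d. eps (u ! j) (v ! j)) = 0"
        using prod_eps_nonzero_iff[OF uv] by blast
      then show ?thesis
        by (simp only: False if_False mult_zero_left)
    qed simp
  qed
  then show ?thesis
    by simp
qed

text \<open>As unordered sets, the pairs of \<open>w\<close> and of \<open>flip w\<close> coincide,
  so for odd \<open>d\<close> there are half as many pairs as words.\<close>

definition flip_pairs :: "nat \<Rightarrow> word set set" where
  "flip_pairs d = (\<lambda>w. {w, flip w}) ` words d"

text \<open>Both words of a pair contribute the same amount because \<open>d\<close> is odd; for even \<open>d\<close> the
  Cayley form is zero.\<close>

lemma cayley_pair_nonzero:
  assumes "odd d" "w \<in> words d"
  shows "cayley d {w, flip w} \<noteq> 0"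
proof -
  let ?s = "\<lambda>u. \<Prod>j<d. eps (u ! j) (flip u ! j)"
  have neq: "flip w \<noteq> w"
    using assms by (intro flip_neq) (auto intro: odd_pos)
  have "cayley d {w, flip w} = (\<Sum>u\<in>{w, flip w}. if u \<noteq> flip u \<and> {w, flip w} = {u, flip u}
     then ?s u * shuffle_sign {u} {flip u} else 0)"
    unfolding cayley_apply by (rule sum.mono_neutral_right) (use assms in \<open>auto simp: doubleton_eq_iff\<close>)
  also have "\<dots> = ?s w * shuffle_sign {w} {flip w} + ?s (flip w) * shuffle_sign {flip w} {w}"
    using neq by (simp add: insert_commute)
  \<comment> \<open>Each of the \<open>d\<close> factors \<open>eps\<close> changes sign, an odd
    number in total; the shuffle sign below changes once more, so the two terms agree.\<close>
  also have "?s (flip w) = - ?s w"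
    using assms(1) by (subst eps_swap) (simp add: prod_uminus)
  also have "shuffle_sign {flip w} {w} = - shuffle_sign {w} {flip w}"
    using shuffle_sign_commute[of "{flip w}" "{w}"] neq by simp
  finally have "cayley d {w, flip w} = 2 * (?s w * shuffle_sign {w} {flip w})"
    by simp
  moreover have "?s w \<noteq> 0"
    using assms by (subst prod_eps_nonzero_iff) auto
  ultimately show ?thesis
    by simp
qed

text \<open>The Cayley form serves as its own coefficient function \<open>\<gamma>\<close>; for hard
  Lefschetz its values on pairs need only be nonzero.\<close>

lemma cayley_pair_form: "cayley d = pair_form (cayley d) (flip_pairs d)"
proof (rule ext)
  fix S
  have "cayley d S = 0" if "S \<notin> flip_pairs d"
    unfolding cayley_apply by (rule sum.neutral) (use that in \<open>auto simp: flip_pairs_def\<close>)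
  then show "cayley d S = pair_form (cayley d) (flip_pairs d) S"
    by (simp add: pair_form_def)
qed

lemma cayley_ext_pow: "odd d \<Longrightarrow> cayley d \<in> ext_pow d 2"
  unfolding ext_pow_def mem_Collect_eq
proof (intro allI impI)
  fix S
  assume d: "odd d" and "cayley d S \<noteq> 0"
  then have "S \<in> flip_pairs d"
    by (metis cayley_pair_form pair_form_nonzeroD)
  then show "S \<subseteq> words d \<and> card S = 2"
    using flip_neq[OF _ odd_pos[OF d]] by (fastforce simp: flip_pairs_def card_insert_if)
qed

lemma
  assumes "odd d"
  shows flip_pairs_card_2: "D \<in> flip_pairs d \<Longrightarrow> card D = 2"
    and Union_flip_pairs: "\<Union>(flip_pairs d) = words d"
    and pairwise_flip_pairs: "pairwise disjnt (flip_pairs d)"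
    and finite_flip_pairs: "finite (flip_pairs d)"
    and card_flip_pairs: "card (flip_pairs d) = 2 ^ (d - 1)"
proof -
  show 2: "card D = 2" if "D \<in> flip_pairs d" for D
    using that flip_neq[OF _ odd_pos[OF assms]] by (fastforce simp: flip_pairs_def card_insert_if)
  show U: "\<Union>(flip_pairs d) = words d"
    by (auto simp: flip_pairs_def)
  have disj: "C \<inter> D = {}" if "C \<in> flip_pairs d" "D \<in> flip_pairs d" "C \<noteq> D" for C D
    using that by (auto simp: flip_pairs_def doubleton_eq_iff)
  then show "pairwise disjnt (flip_pairs d)"
    by (auto simp: pairwise_def disjnt_def)
  show fin: "finite (flip_pairs d)"
    by (simp add: flip_pairs_def)
  have "2 * card (flip_pairs d) = card (\<Union>(flip_pairs d))"
    by (rule card_partition) (use 2 disj fin U in auto)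
  also have "\<dots> = 2 * 2 ^ (d - 1)"
    using odd_pos[OF assms] by (simp add: U card_words flip: power_Suc)
  finally show "card (flip_pairs d) = 2 ^ (d - 1)"
    by simp
qed

lemma ext_pow_eq_rel_pow: "odd d \<Longrightarrow> ext_pow d r = rel_pow (flip_pairs d) {} (int r)"
  using finite_subset[OF _ finite_words[of d]] by (auto simp: ext_pow_def rel_pow_def Union_flip_pairs)

lemma
  assumes "odd d" "l \<le> 2 ^ (d - 1)"
  shows cayley_power_inj: "v \<in> ext_pow d (2 ^ (d - 1) - l) \<Longrightarrow> (wedge (cayley d) ^^ l) v = 0 \<Longrightarrow> v = 0"
    and cayley_power_surj: "w \<in> ext_pow d (2 ^ (d - 1) + l) \<Longrightarrow>
      \<exists>v \<in> ext_pow d (2 ^ (d - 1) - l). (wedge (cayley d) ^^ l) v = w"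
proof -
  have pairs: "card D = 2 \<and> cayley d D \<noteq> 0" if "D \<in> flip_pairs d" for D
    using that flip_pairs_card_2 cayley_pair_nonzero assms(1) by (auto simp: flip_pairs_def)
  note * = hard_lefschetz[where \<gamma> = "cayley d" and T = "{}" and k = l,
      OF finite_flip_pairs[OF assms(1)] pairs pairwise_flip_pairs[OF assms(1)] finite.emptyI Int_empty_left,
      folded cayley_pair_form, unfolded card_flip_pairs[OF assms(1)]]
  \<comment> \<open>Returns from integer degrees to natural ones; the bound on \<open>l\<close>
    keeps the subtraction from being truncated.\<close>
  have "int (2 ^ (d - 1)) - int l = int (2 ^ (d - 1) - l)" "int (2 ^ (d - 1)) + int l = int (2 ^ (d - 1) + l)"
    using assms(2) by (simp_all add: of_nat_diff)
  note * = *[unfolded this, folded ext_pow_eq_rel_pow[OF assms(1)]]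
  show "v \<in> ext_pow d (2 ^ (d - 1) - l) \<Longrightarrow> (wedge (cayley d) ^^ l) v = 0 \<Longrightarrow> v = 0"
    using * by blast
  show "w \<in> ext_pow d (2 ^ (d - 1) + l) \<Longrightarrow>
      \<exists>v \<in> ext_pow d (2 ^ (d - 1) - l). (wedge (cayley d) ^^ l) v = w"
    using * by blast
qed

subsection \<open>Highest weight vectors\<close>

lemma ext_act_cayley_power:
  "ext_act d g ((wedge (cayley d) ^^ l) v) =
    ext_scale ((\<Prod>j<d. det (g j)) ^ l) ((wedge (cayley d) ^^ l) (ext_act d g v))"
  by (induction l) (simp_all add: ext_act_wedge ext_act_cayley wedge_scale_left wedge_scale_right mult.commute)

lemma wedge_ext_pow:
  assumes "u \<in> ext_pow d k" "v \<in> ext_pow d r"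
  shows "wedge u v \<in> ext_pow d (k + r)"
  unfolding ext_pow_def mem_Collect_eq
proof (intro allI impI)
  fix S
  assume "wedge u v S \<noteq> 0"
  then obtain A where A: "A \<subseteq> S" "finite S" "u A \<noteq> 0" "v (S - A) \<noteq> 0"
    by (rule wedge_nonzeroE)
  have "card S = card A + card (S - A)"
    using A(1,2) by (metis card_Diff_subset card_mono finite_subset le_add_diff_inverse)
  moreover have "A \<subseteq> words d \<and> card A = k" "S - A \<subseteq> words d \<and> card (S - A) = r"
    using A(3,4) assms unfolding ext_pow_def by blast+
  ultimately show "S \<subseteq> words d \<and> card S = k + r"
    by auto
qed

lemma cayley_power_ext_pow:
  assumes "odd d" "v \<in> ext_pow d r"
  shows "(wedge (cayley d) ^^ l) v \<in> ext_pow d (r + 2 * l)"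
proof (induction l)
  case (Suc l)
  show ?case
    using wedge_ext_pow[OF cayley_ext_pow[OF assms(1)] Suc] by (simp add: algebra_simps)
qed (use assms in simp)

lemma det_diag_mat: "det (diag_mat a) = (\<Prod>i\<in>UNIV. a $ i)" for a :: "complex^2"
  by (simp add: det_2 diag_mat_def UNIV_2)

lemma det_upper_unitriangular: "upper_unitriangular A \<Longrightarrow> det A = 1"
  by (simp add: det_2 upper_unitriangular_def)

lemma ext_pow_scale: "v \<in> ext_pow d r \<Longrightarrow> ext_scale c v \<in> ext_pow d r"
  by (auto simp: ext_pow_def ext_scale_def)

lemma ext_pow_add: "u \<in> ext_pow d r \<Longrightarrow> v \<in> ext_pow d r \<Longrightarrow> u + v \<in> ext_pow d r"
  unfolding ext_pow_def mem_Collect_eq plus_fun_apply by (metis add.right_neutral)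

lemma cayley_power_inj_eq:
  assumes "odd d" "l \<le> 2 ^ (d - 1)" "u \<in> ext_pow d (2 ^ (d - 1) - l)" "v \<in> ext_pow d (2 ^ (d - 1) - l)"
    and eq: "(wedge (cayley d) ^^ l) u = (wedge (cayley d) ^^ l) v"
  shows "u = v"
proof -
  have "(wedge (cayley d) ^^ l) (u + ext_scale (- 1) v) = 0"
    unfolding funpow_wedge_add funpow_wedge_scale eq by (simp add: ext_scale_def fun_eq_iff)
  then have "u + ext_scale (- 1) v = 0"
    by (rule cayley_power_inj[OF assms(1,2), rotated]) (intro ext_pow_add ext_pow_scale assms)
  then show ?thesis
    by (simp add: ext_scale_def fun_eq_iff)
qed

lemma HWV_subspace:
  shows "0 \<in> HWV d \<mu> r"
    and "u \<in> HWV d \<mu> r \<Longrightarrow> v \<in> HWV d \<mu> r \<Longrightarrow> u + v \<in> HWV d \<mu> r"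
    and "v \<in> HWV d \<mu> r \<Longrightarrow> ext_scale c v \<in> HWV d \<mu> r"
proof -
  show "0 \<in> HWV d \<mu> r"
    by (simp add: HWV_def weight_vector_def ext_pow_def del: zero_fun_apply) simp
  show "u + v \<in> HWV d \<mu> r" if "u \<in> HWV d \<mu> r" "v \<in> HWV d \<mu> r"
    using that ext_pow_add unfolding HWV_def weight_vector_def mem_Collect_eq
    by (simp add: ext_act_add ext_scale_add del: plus_fun_apply)
  show "ext_scale c v \<in> HWV d \<mu> r" if "v \<in> HWV d \<mu> r"
    using that ext_pow_scale unfolding HWV_def weight_vector_def mem_Collect_eq
    by (simp add: ext_act_scale mult.commute)
qed

text \<open>Multiplication by \<open>\<omega>\<^sup>l\<close> is injective and intertwines the group action up to a power of the
  determinants, so it reflects highest weight vectors as well as preserving them.\<close>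

lemma cayley_power_HWV_iff:
  assumes d: "odd d" and l: "l \<le> 2 ^ (d - 1)" and v: "v \<in> ext_pow d (2 ^ (d - 1) - l)"
  shows "(wedge (cayley d) ^^ l) v \<in> HWV d (\<lambda>j. \<mu> j + vector [int l, int l]) (2 ^ (d - 1) + l) \<longleftrightarrow>
    v \<in> HWV d \<mu> (2 ^ (d - 1) - l)"
proof -
  let ?X = "wedge (cayley d) ^^ l" and ?N = "2 ^ (d - 1) :: nat"
  have Xv: "?X v \<in> ext_pow d (?N + l)"
    using cayley_power_ext_pow[OF d v, of l] l by (simp add: algebra_simps)
  have X_eq: "?X u = ?X w \<longleftrightarrow> u = w" if "u \<in> ext_pow d (?N - l)" "w \<in> ext_pow d (?N - l)" for u w
    using cayley_power_inj_eq[OF d l that] by blast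
  have unitri: "ext_act d g (?X v) = ?X v \<longleftrightarrow> ext_act d g v = v"
    if "\<forall>j<d. upper_unitriangular (g j)" for g
  proof -
    have "(\<Prod>j<d. det (g j)) = 1"
      using that by (intro prod.neutral) (auto intro: det_upper_unitriangular)
    \<comment> \<open>With determinant \<open>1\<close> the group commutes with \<open>?X\<close>,
      and injectivity is applied to the vectors \<open>ext_act d g v\<close> and \<open>v\<close> of
      equal degree.\<close>
    then show ?thesis
      using X_eq[OF ext_act_ext_pow[OF v] v] by (simp add: ext_act_cayley_power)
  qed
  have diag: "ext_act d (\<lambda>j. diag_mat (a j)) (?X v) =
        ext_scale (\<Prod>j<d. \<Prod>i\<in>UNIV. a j $ i powi ((\<mu> j + vector [int l, int l]) $ i)) (?X v) \<longleftrightarrow>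
      ext_act d (\<lambda>j. diag_mat (a j)) v = ext_scale (\<Prod>j<d. \<Prod>i\<in>UNIV. a j $ i powi (\<mu> j $ i)) v"
    if a: "\<forall>j<d. \<forall>i. a j $ i \<noteq> 0" for a :: "nat \<Rightarrow> complex^2"
  proof -
    \<comment> \<open>The scalar by which the torus acts on \<open>\<omega>\<^sup>l\<close>. It is
      also the quotient of the characters of \<open>\<mu> + (l, l)\<close> and \<open>\<mu>\<close>,
      and being nonzero it cancels.\<close>
    define c where "c = (\<Prod>j<d. \<Prod>i\<in>UNIV. a j $ i) ^ l"
    define m where "m = (\<Prod>j<d. \<Prod>i\<in>UNIV. a j $ i powi (\<mu> j $ i))"
    have c: "c \<noteq> 0"
      using a by (simp add: c_def)
    have vec: "(vector [int l, int l] :: int^2) $ i = int l" for i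
      using exhaust_2[of i] by auto
    have "(\<Prod>j<d. \<Prod>i\<in>UNIV. a j $ i powi ((\<mu> j + vector [int l, int l]) $ i)) =
        (\<Prod>j<d. \<Prod>i\<in>UNIV. (a j $ i) ^ l * a j $ i powi (\<mu> j $ i))"
      using a by (intro prod.cong refl) (simp add: vec power_int_add)
    also have "\<dots> = c * m"
      by (simp add: prod.distrib c_def m_def prod_power_distrib)
    finally have *: "(\<Prod>j<d. \<Prod>i\<in>UNIV. a j $ i powi ((\<mu> j + vector [int l, int l]) $ i)) = c * m" .
    have "ext_act d (\<lambda>j. diag_mat (a j)) (?X v) = ext_scale c (?X (ext_act d (\<lambda>j. diag_mat (a j)) v))"
      by (simp add: ext_act_cayley_power c_def det_diag_mat)
    moreover have "ext_scale (c * m) (?X v) = ext_scale c (?X (ext_scale m v))"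
      by (simp add: funpow_wedge_scale)
    moreover have "ext_scale c x = ext_scale c y \<longleftrightarrow> x = y" for x y
      using c by (simp add: ext_scale_def fun_eq_iff)
    ultimately show ?thesis
      unfolding * m_def[symmetric] using X_eq[OF ext_act_ext_pow[OF v] ext_pow_scale[OF v]] by simp
  qed
  show ?thesis
    unfolding HWV_def weight_vector_def mem_Collect_eq using v Xv unitri diag by simp
qed

section \<open>The spaces \<open>U\<^sub>r\<close> and the restriction of the Lefschetz map to
  them\<close>

lemma hw_space_eq:
  "hw_space d m lam (m + 2 * n) = (if n \<le> 2 ^ (d - 1) - m
    then HWV d (\<lambda>j. two_rows (conj_partition (lam j)) + vector [int n, int n]) (m + 2 * n) else {0})"
  using HWV_subspace(1) by (auto simp: hw_space_def)

lemma hw_space_trivial: "(\<And>n. n \<le> 2 ^ (d - 1) - m \<Longrightarrow> r \<noteq> m + 2 * n) \<Longrightarrow> hw_space d m lam r = {0}"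
  by (auto simp: hw_space_def)

lemma module_ext_scale: "module ext_scale"
  by unfold_locales (auto simp: ext_scale_def fun_eq_iff algebra_simps)

lemma hw_space_subspace: "module.subspace ext_scale (hw_space d m lam r)"
proof (cases "\<exists>n \<le> 2 ^ (d - 1) - m. r = m + 2 * n")
  case True
  then show ?thesis
    using HWV_subspace unfolding module.subspace_def[OF module_ext_scale] by (auto simp: hw_space_eq)
next
  case False
  then have "hw_space d m lam r = {0}"
    by (intro hw_space_trivial) auto
  then show ?thesis
    unfolding module.subspace_def[OF module_ext_scale] by simp
qed

lemma cayley_power_bij_betw_hw_space:
  assumes d: "odd d" and m: "m \<le> 2 ^ (d - 1)" and l: "l \<le> 2 ^ (d - 1)"
  shows "bij_betw (wedge (cayley d) ^^ l)
    (hw_space d m lam (2 ^ (d - 1) - l)) (hw_space d m lam (2 ^ (d - 1) + l))"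
proof (cases "\<exists>n \<le> 2 ^ (d - 1) - m. 2 ^ (d - 1) - l = m + 2 * n")
  case True
  let ?X = "wedge (cayley d) ^^ l" and ?N = "2 ^ (d - 1) :: nat"
  from True obtain n where n: "n \<le> ?N - m" "?N - l = m + 2 * n"
    by blast
  define \<mu> where "\<mu> = (\<lambda>j. two_rows (conj_partition (lam j)) + vector [int n, int n] :: int^2)"
  have U: "hw_space d m lam (?N - l) = HWV d \<mu> (?N - l)"
    using n by (simp add: hw_space_eq \<mu>_def)
  \<comment> \<open>Hence the target has index \<open>n + l\<close>, whose weight differs from that
    of index \<open>n\<close> by exactly \<open>(l, l)\<close>, and \<open>n + l\<close> is
    admissible since \<open>?N - m = 2 * n + l\<close>.\<close>
  have N: "?N = m + 2 * n + l"
    using n(2) l by linarith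
  have Nl: "?N + l = m + 2 * (n + l)" and le: "n + l \<le> ?N - m"
    unfolding N by simp_all
  have vec: "(vector [int n, int n] + vector [int l, int l] :: int^2) = vector [int (n + l), int (n + l)]"
    by (simp add: vec_eq_iff forall_2)
  have W: "hw_space d m lam (?N + l) = HWV d (\<lambda>j. \<mu> j + vector [int l, int l]) (?N + l)"
    unfolding Nl using le by (simp only: hw_space_eq if_True \<mu>_def add.assoc vec)
  have ext: "v \<in> ext_pow d r" if "v \<in> HWV d \<nu> r" for v \<nu> r
    using that by (simp add: HWV_def)
  show ?thesis
    unfolding U W bij_betw_def
  proof
    show "inj_on ?X (HWV d \<mu> (?N - l))"
      by (rule inj_onI) (use cayley_power_inj_eq[OF d l] ext in blast)
    show "?X ` HWV d \<mu> (?N - l) = HWV d (\<lambda>j. \<mu> j + vector [int l, int l]) (?N + l)"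
    proof (intro equalityI subsetI)
      fix w assume "w \<in> ?X ` HWV d \<mu> (?N - l)"
      then show "w \<in> HWV d (\<lambda>j. \<mu> j + vector [int l, int l]) (?N + l)"
        using cayley_power_HWV_iff[OF d l] ext by blast
    next
      fix w assume w: "w \<in> HWV d (\<lambda>j. \<mu> j + vector [int l, int l]) (?N + l)"
      then obtain v where v: "v \<in> ext_pow d (?N - l)" "?X v = w"
        using cayley_power_surj[OF d l] ext by blast
      then have "v \<in> HWV d \<mu> (?N - l)"
        using cayley_power_HWV_iff[OF d l v(1)] w by blast
      with v(2) show "w \<in> ?X ` HWV d \<mu> (?N - l)"
        by blast
    qed
  qed
next
  case False
  \<comment> \<open>An admissible index \<open>n\<close> for the target would make
    \<open>n - l\<close> admissible for the source, with \<open>l \<le> n\<close> forced by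
    \<open>n \<le> 2 ^ (d - 1) - m\<close>. So outside the admissible degrees both spaces are
    zero.\<close>
  have neq: "2 ^ (d - 1) + l \<noteq> m + 2 * n" if "n \<le> 2 ^ (d - 1) - m" for n
  proof
    assume *: "2 ^ (d - 1) + l = m + 2 * n"
    then have "l \<le> n"
      using that m by linarith
    then have "n - l \<le> 2 ^ (d - 1) - m" "2 ^ (d - 1) - l = m + 2 * (n - l)"
      using * that by linarith+
    with False show False
      by blast
  qed
  have "hw_space d m lam (2 ^ (d - 1) + l) = {0}"
    by (rule hw_space_trivial) (rule neq)
  moreover have "hw_space d m lam (2 ^ (d - 1) - l) = {0}"
    by (rule hw_space_trivial) (use False in blast)
  ultimately show ?thesis
    by (simp add: bij_betw_def del: zero_fun_apply)
qed

theorem corollary5p8: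
  fixes d m :: nat and lam :: "nat \<Rightarrow> nat \<Rightarrow> nat"
  assumes "d \<ge> 3" and "odd d"
    and "m \<le> 2 ^ (d - 1)"
    and "\<And>j. j < d \<Longrightarrow> is_partition m (lam j)"
    and "\<And>j i. j < d \<Longrightarrow> lam j i \<le> 2"
    and "conj_partition (lam 0) = single_row m"
  shows "\<forall>l \<in> (if even m then {0..m div 2} else {1..m div 2}).
    linear_iso (hw_space d m lam (2 ^ (d - 1) - l)) (hw_space d m lam (2 ^ (d - 1) + l))
      (wedge (cayley d) ^^ l)"
proof
  fix l
  assume "l \<in> (if even m then {0..m div 2} else {1..m div 2})"
  then have "l \<le> m div 2"
    by (auto split: if_splits)
  then have "l \<le> 2 ^ (d - 1)"
    using assms(3) by linarith
  then show "linear_iso (hw_space d m lam (2 ^ (d - 1) - l)) (hw_space d m lam (2 ^ (d - 1) + l))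
      (wedge (cayley d) ^^ l)"
    unfolding linear_iso_def
    by (intro conjI ballI allI hw_space_subspace funpow_wedge_add funpow_wedge_scale
      cayley_power_bij_betw_hw_space[OF assms(2,3)])
qed

end
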